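(* Let $(X,d,\varphi)$ be an irreducible Smale space. Then $\lambda(X,\varphi)<\infty$ if and only if $\dim X>0$. Specifically, if $\dim X>0$ then $$\lambda(X,\varphi)\le e^{2h(\varphi)/\dim X}.$$
   Context: All Smale spaces have infinite underlying space. A Smale space $(X,d,\varphi)$ is a compact metric space $(X,d)$ with a homeomorphism $\varphi:X\to X$, constants $\varepsilon_X>0$, $\lambda_X>1$ and a continuous map $[\cdot,\cdot]:\{(x,y)\in X\times X:d(x,y)\le\varepsilon_X\}\to X$ satisfying $[x,x]=x$, $[x,[y,z]]=[x,z]$, $[[x,y],z]=[x,z]$, $\varphi([x,y])=[\varphi(x),\varphi(y)]$ whenever both sides are defined, and such that, writing for $0<\varepsilon\le\varepsilon_X$ $$X^s(x,\varepsilon)=\{y:d(x,y)<\varepsilon,\ [x,y]=y\},\qquad X^u(x,\varepsilon)=\{y:d(x,y)<\varepsilon,\ [y,x]=y\},$$ one has $d(\varphi(y),\varphi(z))\le\lambda_X^{-1}d(y,z)$ for $y,z\in X^s(x,\varepsilon)$ and $d(\varphi^{-1}(y),\varphi^{-1}(z))\le\lambda_X^{-1}d(y,z)$ for $y,z\in X^u(x,\varepsilon)$. It is irreducible if for all non-empty open $U,V\subset X$ there is $n\in\mathbb N$ with $\varphi^n(U)\cap V\ne\varnothing$. It is self-similar if $\varphi$ and $\varphi^{-1}$ are both $\lambda_X$-Lipschitz. $\mathrm{sM}_d(X,\varphi)$ is the (non-empty) set of metrics $d'$ on $X$ inducing the same topology as $d$ for which $(X,d',\varphi)$ is a self-similar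 Smale space, with contraction constant $\lambda_{X,d'}>1$. The $\lambda$-number is $\lambda(X,\varphi)=\sup\{\lambda_{X,d'}:d'\in\mathrm{sM}_d(X,\varphi)\}\in(1,\infty]$. $\dim X$ is the topological (covering) dimension, which is always finite for Smale spaces, and $h(\varphi)$ is the topological entropy. *)

theory Defs
  imports "HOL-Analysis.Analysis"
begin

section \<open>Open covers and covering dimension\<close>

definition open_cover :: "'a topology \<Rightarrow> 'a set set \<Rightarrow> bool" where
  "open_cover T \<U> \<longleftrightarrow> (\<forall>U\<in>\<U>. openin T U) \<and> \<Union>\<U> = topspace T"

definition refines :: "'a set set \<Rightarrow> 'a set set \<Rightarrow> bool" where
  "refines \<V> \<U> \<longleftrightarrow> (\<forall>V\<in>\<V>. \<exists>U\<in>\<U>. V \<subseteq> U)"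

text \<open>The finiteness conjunct is needed because \<^const>\<open>card\<close> is 0 on infinite sets.\<close>

definition covering_dim_le :: "'a topology \<Rightarrow> nat \<Rightarrow> bool" where
  "covering_dim_le T n \<longleftrightarrow>
     (\<forall>\<U>. open_cover T \<U> \<longrightarrow>
        (\<exists>\<V>. open_cover T \<V> \<and> refines \<V> \<U> \<and>
             (\<forall>x\<in>topspace T. finite {V\<in>\<V>. x \<in> V} \<and> card {V\<in>\<V>. x \<in> V} \<le> n + 1)))"

text \<open>The value is \<open>\<infinity>\<close> if no bound exists.  The exceptional value \<open>-1\<close> for the empty
  space is not represented; only non-empty spaces are considered below.\<close>

definition covering_dim :: "'a topology \<Rightarrow> enat" where
  "covering_dim T = Inf (enat ` {n. covering_dim_le T n})"


section \<open>Topological entropy\<close>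

text \<open>Adler--Konheim--McAndrew definition through open covers.  Below, \<open>cover_join T f \<U> n\<close> is the
  join of the pullbacks of \<open>\<U>\<close> under \<open>f ^^ i\<close> for \<open>i < n\<close>, and \<open>cover_number\<close> is the least
  cardinality of a subcover (one that is finite, which always exists in a compact space).\<close>

definition cover_join :: "'a topology \<Rightarrow> ('a \<Rightarrow> 'a) \<Rightarrow> 'a set set \<Rightarrow> nat \<Rightarrow> 'a set set" where
  "cover_join T f \<U> n =
     {{x \<in> topspace T. \<forall>i<n. (f ^^ i) x \<in> W i} | W. \<forall>i<n. W i \<in> \<U>}"

definition cover_number :: "'a topology \<Rightarrow> 'a set set \<Rightarrow> nat" where
  "cover_number T \<U> = (LEAST k. \<exists>\<C>\<subseteq>\<U>. finite \<C> \<and> topspace T \<subseteq> \<Union>\<C> \<and> card \<C> = k)"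

text \<open>The sequence converges by subadditivity, so the limit superior is the limit.\<close>

definition cover_entropy :: "'a topology \<Rightarrow> ('a \<Rightarrow> 'a) \<Rightarrow> 'a set set \<Rightarrow> ereal" where
  "cover_entropy T f \<U> =
     limsup (\<lambda>n. ereal (ln (real (cover_number T (cover_join T f \<U> n))) / real n))"

definition topological_entropy :: "'a topology \<Rightarrow> ('a \<Rightarrow> 'a) \<Rightarrow> ereal" where
  "topological_entropy T f = (SUP \<U>\<in>{\<U>. open_cover T \<U>}. cover_entropy T f \<U>)"

fun exp_ereal :: "ereal \<Rightarrow> ereal" where
  "exp_ereal (ereal r) = ereal (exp r)"
| "exp_ereal PInfty = \<infinity>"
| "exp_ereal MInfty = 0"


section \<open>Smale spaces\<close>

definition local_stable :: "'a set \<Rightarrow> ('a \<Rightarrow> 'a \<Rightarrow> real) \<Rightarrow> ('a \<Rightarrow> 'a \<Rightarrow> 'a) \<Rightarrow> 'a \<Rightarrow> real \<Rightarrow> 'a set" where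
  "local_stable M d br x e = {y\<in>M. d x y < e \<and> br x y = y}"

definition local_unstable :: "'a set \<Rightarrow> ('a \<Rightarrow> 'a \<Rightarrow> real) \<Rightarrow> ('a \<Rightarrow> 'a \<Rightarrow> 'a) \<Rightarrow> 'a \<Rightarrow> real \<Rightarrow> 'a set" where
  "local_unstable M d br x e = {y\<in>M. d x y < e \<and> br y x = y}"

text \<open>The bracket is a total function whose values matter only at pairs of points of \<open>M\<close> at distance
  at most \<open>eps\<close>; the identities are required whenever both of their sides are defined.\<close>

locale smale_space = Metric_space M d
  for M :: "'a set" and d :: "'a \<Rightarrow> 'a \<Rightarrow> real" +
  fixes \<phi> :: "'a \<Rightarrow> 'a" and eps lam :: real and br :: "'a \<Rightarrow> 'a \<Rightarrow> 'a"
  assumes infinite_carrier: "infinite M"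
    and compact: "compact_space mtopology"
    and homeo: "homeomorphic_map mtopology mtopology \<phi>"
    and eps_pos: "0 < eps"
    and lam_gt_1: "1 < lam"
    and bracket_continuous:
      "continuous_map
         (subtopology (prod_topology mtopology mtopology) {(x, y). x \<in> M \<and> y \<in> M \<and> d x y \<le> eps})
         mtopology (\<lambda>(x, y). br x y)"
    and bracket_same: "\<And>x. x \<in> M \<Longrightarrow> br x x = x"
    and bracket_right:
      "\<And>x y z. \<lbrakk>x \<in> M; y \<in> M; z \<in> M; d y z \<le> eps; d x (br y z) \<le> eps; d x z \<le> eps\<rbrakk>
         \<Longrightarrow> br x (br y z) = br x z"
    and bracket_left:
      "\<And>x y z. \<lbrakk>x \<in> M; y \<in> M; z \<in> M; d x y \<le> eps; d (br x y) z \<le> eps; d x z \<le> eps\<rbrakk>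
         \<Longrightarrow> br (br x y) z = br x z"
    and bracket_equivariant:
      "\<And>x y. \<lbrakk>x \<in> M; y \<in> M; d x y \<le> eps; d (\<phi> x) (\<phi> y) \<le> eps\<rbrakk>
         \<Longrightarrow> \<phi> (br x y) = br (\<phi> x) (\<phi> y)"
    and stable_contraction:
      "\<And>x y z e. \<lbrakk>x \<in> M; 0 < e; e \<le> eps; y \<in> local_stable M d br x e; z \<in> local_stable M d br x e\<rbrakk>
         \<Longrightarrow> d (\<phi> y) (\<phi> z) \<le> inverse lam * d y z"
    and unstable_contraction:
      "\<And>x y z e. \<lbrakk>x \<in> M; 0 < e; e \<le> eps; y \<in> local_unstable M d br x e; z \<in> local_unstable M d br x e\<rbrakk>
         \<Longrightarrow> d (inv_into M \<phi> y) (inv_into M \<phi> z) \<le> inverse lam * d y z"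

definition irreducible_system :: "'a topology \<Rightarrow> ('a \<Rightarrow> 'a) \<Rightarrow> bool" where
  "irreducible_system T f \<longleftrightarrow>
     (\<forall>U V. openin T U \<and> U \<noteq> {} \<and> openin T V \<and> V \<noteq> {} \<longrightarrow> (\<exists>n::nat. (f ^^ n) ` U \<inter> V \<noteq> {}))"

locale self_similar_smale_space = smale_space +
  assumes lipschitz: "\<And>x y. \<lbrakk>x \<in> M; y \<in> M\<rbrakk> \<Longrightarrow> d (\<phi> x) (\<phi> y) \<le> lam * d x y"
    and lipschitz_inv:
      "\<And>x y. \<lbrakk>x \<in> M; y \<in> M\<rbrakk> \<Longrightarrow> d (inv_into M \<phi> x) (inv_into M \<phi> y) \<le> lam * d x y"

definition self_similar_constant :: "'a set \<Rightarrow> ('a \<Rightarrow> 'a \<Rightarrow> real) \<Rightarrow> ('a \<Rightarrow> 'a) \<Rightarrow> real \<Rightarrow> bool" where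
  "self_similar_constant M d \<phi> lam \<longleftrightarrow> (\<exists>eps br. self_similar_smale_space M d \<phi> eps lam br)"

definition self_similar_metrics ::
    "'a set \<Rightarrow> ('a \<Rightarrow> 'a \<Rightarrow> real) \<Rightarrow> ('a \<Rightarrow> 'a) \<Rightarrow> ('a \<Rightarrow> 'a \<Rightarrow> real) set" where
  "self_similar_metrics M d \<phi> =
     {d'. Metric_space M d' \<and> Metric_space.mtopology M d' = Metric_space.mtopology M d \<and>
          (\<exists>lam. self_similar_constant M d' \<phi> lam)}"

text \<open>The contraction constant \<open>lam\<close> is determined by the self-similar metric \<open>d'\<close>: together with the
  Lipschitz bounds the contraction inequalities become equalities, \<open>\<phi>\<close> determines the bracket on
  nearby points, and as \<open>M\<close> is infinite, arbitrarily small local stable or unstable sets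
  are non-trivial.  So for each \<open>d'\<close> exactly one number is contributed to the supremum.\<close>

definition lambda_number :: "'a set \<Rightarrow> ('a \<Rightarrow> 'a \<Rightarrow> real) \<Rightarrow> ('a \<Rightarrow> 'a) \<Rightarrow> ereal" where
  "lambda_number M d \<phi> =
     Sup {ereal lam | d' lam. d' \<in> self_similar_metrics M d \<phi> \<and> self_similar_constant M d' \<phi> lam}"

end

theory Submission
  imports Defs
begin

text \<open>
  The upper bound compares three quantities: covering dimension, the growth of the number of small sets
  needed to cover the space, and entropy.  The bridge between the last two is hyperbolicity.  If the
  orbits of \<open>x\<close> and \<open>y\<close> stay close for \<open>2 * n\<close> steps, the bracket point \<open>z = [x, y]\<close> follows the orbit
  of \<open>x\<close> forwards along a stable set and that of \<open>y\<close> backwards along an unstable set, so midway, at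
  time \<open>n\<close>, both orbits are within a constant times \<open>lam ^ (-n)\<close> of it (\<open>exponential_tracking\<close>).
  Hence the \<open>n\<close>-th image of a cylinder of length \<open>2 * n + 1\<close> over a fine cover has diameter of order
  \<open>lam ^ (-n)\<close>, and with entropy \<open>h\<close> the space is covered by about \<open>exp (2 * n * h)\<close> such sets.
  This makes the box dimension at most \<open>2 * h / ln lam\<close>.

  The covering dimension is at most the box dimension (\<open>covering_dim_le_if_few_small_sets\<close>).  Cover
  the space by balls around a finite net.  If the space is covered by few sets of diameter \<open>r\<close>, the radii
  can be chosen so that no point is \<open>r\<close>-close to \<open>n + 1\<close> of the spheres at once
  (\<open>generic_radii\<close>, by counting choices of radii on a grid).  Removing from each ball the
  earlier ones leaves pieces that overlap only near spheres, hence of order at most \<open>n + 1\<close>.  Together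
  this gives \<open>dim X * ln lam \<le> 2 * h\<close> for every Smale metric in the given topology.  A cover finer than the
  tracking scale is a generator, so the entropy is a real number
  (\<open>topological_entropy_real\<close>), and the bound on \<open>lam\<close> is finite.

  In dimension \<open>0\<close> there is a partition into clopen sets finer than the tracking scale.  For any
  \<open>L > 1\<close> the distance \<open>L ^ (-n)\<close>, where \<open>n - 1\<close> is the least \<open>\<bar>i\<bar>\<close> such that the two-sided
  itineraries differ at time \<open>i\<close>, is a metric for the same topology.  Points on a common small stable set have equal forward
  itineraries, so applying \<open>\<phi>\<close> pushes the first difference one step away: the
  metric is self-similar with constant \<open>L\<close> for the original bracket
  (\<open>zero_dim_self_similar_constant\<close>).  Since \<open>L\<close> is arbitrary, the \<open>\<lambda>\<close>-number is infinite.
\<close>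

section \<open>Covering dimension and the number of small sets in a cover\<close>

lemma (in Metric_space) Lebesgue_number:
  assumes comp: "compact_space mtopology" and cover: "open_cover mtopology \<U>"
  obtains \<rho> where "0 < \<rho>" "\<And>x. x \<in> M \<Longrightarrow> \<exists>U\<in>\<U>. mball x \<rho> \<subseteq> U"
proof -
  have "\<exists>r>0. \<exists>U\<in>\<U>. mball x (2 * r) \<subseteq> U" if "x \<in> M" for x
  proof -
    obtain U where U: "U \<in> \<U>" "x \<in> U" "openin mtopology U"
      using cover \<open>x \<in> M\<close> unfolding open_cover_def topspace_mtopology by blast
    then obtain r where "r > 0" "mball x r \<subseteq> U"
      unfolding openin_mtopology by blast
    then show ?thesis using U(1) by (intro exI[of _ "r / 2"]) auto
  qed
  then obtain r where r: "\<And>x. x \<in> M \<Longrightarrow> r x > 0"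
      "\<And>x. x \<in> M \<Longrightarrow> \<exists>U\<in>\<U>. mball x (2 * r x) \<subseteq> U" by metis
  define \<B> where "\<B> = (\<lambda>x. mball x (r x)) ` M"
  have "\<exists>\<F>. finite \<F> \<and> \<F> \<subseteq> \<B> \<and> M \<subseteq> \<Union>\<F>"
  proof (rule compactinD)
    show "compactin mtopology M" using comp by (simp add: compact_space_def)
    show "openin mtopology U" if "U \<in> \<B>" for U using that by (auto simp: \<B>_def)
    show "M \<subseteq> \<Union>\<B>" using r(1) by (auto simp: \<B>_def)
  qed
  then obtain \<F> where \<F>: "finite \<F>" "\<F> \<subseteq> (\<lambda>x. mball x (r x)) ` M" "M \<subseteq> \<Union>\<F>"
    unfolding \<B>_def by (elim exE conjE)
  then obtain K where "K \<subseteq> M" "finite K" "\<F> = (\<lambda>x. mball x (r x)) ` K"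
    using finite_subset_image[OF \<F>(1,2)] by blast
  with \<F>(3) have K: "finite K" "K \<subseteq> M" "M \<subseteq> (\<Union>x\<in>K. mball x (r x))" by simp_all
  define \<rho> where "\<rho> = Min (insert 1 (r ` K))"
  have pos: "\<rho> > 0" unfolding \<rho>_def using K r(1) by (subst Min_gr_iff) auto
  have le: "\<rho> \<le> r x" if "x \<in> K" for x unfolding \<rho>_def using K that by auto
  show thesis
  proof (rule that[OF pos])
    fix y assume y: "y \<in> M"
    then obtain x where x: "x \<in> K" "y \<in> mball x (r x)" using K by blast
    obtain U where U: "U \<in> \<U>" "mball x (2 * r x) \<subseteq> U" using r K x by blast
    have "mball y \<rho> \<subseteq> mball x (2 * r x)"
      using le[OF x(1)] x(2) K by (intro mball_subset) (auto simp: commute)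
    then show "\<exists>U\<in>\<U>. mball y \<rho> \<subseteq> U" using U by blast
  qed
qed

lemma (in Metric_space) finite_net:
  assumes "compact_space mtopology" "0 < r"
  obtains K where "finite K" "K \<subseteq> M" "M \<subseteq> (\<Union>x\<in>K. mball x r)"
  using assms compactin_imp_mtotally_bounded[of M]
  unfolding mtotally_bounded_def compact_space_def topspace_mtopology by metis

definition (in Metric_space) mesh_le :: "'a set set \<Rightarrow> real \<Rightarrow> bool" where
  "mesh_le \<A> r \<longleftrightarrow> (\<forall>A\<in>\<A>. \<forall>x\<in>A. \<forall>y\<in>A. d x y \<le> r)"

text \<open>
  A family of grid points whose \<open>S\<close>-coordinates are all equal embeds into the grid over the remaining
  coordinates.  This is the counting that replaces a null set argument in the choice of generic radii.
\<close>

lemma card_PiE_determined_le: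
  assumes "finite I" "S \<subseteq> I"
    and B: "B \<subseteq> (I \<rightarrow>\<^sub>E {..<K::nat})"
    and det: "\<And>k k' i. \<lbrakk>k \<in> B; k' \<in> B; i \<in> S\<rbrakk> \<Longrightarrow> k i = k' i"
  shows "card B \<le> K ^ (card I - card S)"
proof -
  have "inj_on (\<lambda>k. restrict k (I - S)) B"
  proof (rule inj_onI)
    fix k k' assume k: "k \<in> B" "k' \<in> B" and eq: "restrict k (I - S) = restrict k' (I - S)"
    have "k i = k' i" if "i \<in> I" for i
      using det[OF k] fun_cong[OF eq, of i] that by (cases "i \<in> S") auto
    then show "k = k'" using k B by (meson PiE_ext subsetD)
  qed
  moreover have "(\<lambda>k. restrict k (I - S)) ` B \<subseteq> ((I - S) \<rightarrow>\<^sub>E {..<K})"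
    using B unfolding image_subset_iff restrict_PiE_iff by (metis Diff_iff PiE_mem restrict_apply subsetD)
  ultimately have "card B \<le> card ((I - S) \<rightarrow>\<^sub>E {..<K})"
    using assms(1) by (intro card_inj_on_le) (auto intro: finite_PiE)
  also have "\<dots> = K ^ (card I - card S)"
    using assms(1,2) finite_subset[OF assms(2,1)] by (subst card_PiE) (auto simp: card_Diff_subset)
  finally show ?thesis .
qed

text \<open>
  Radii avoiding coincidences exist by counting.  All radii are taken from \<open>K\<close> values with spacing
  \<open>4 * r\<close>.  As a set \<open>A\<close> of diameter at most \<open>r\<close> meets the \<open>r\<close>-neighbourhood of the sphere around
  \<open>i\<close> for at most one value of the radius, a choice of radii is spoiled by \<open>A\<close> and \<open>S\<close> only if its
  \<open>Suc n\<close> coordinates in \<open>S\<close> take prescribed values: a fraction of at most \<open>K ^ (- Suc n)\<close> of all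
  choices.  There are fewer than \<open>K ^ Suc n\<close> pairs \<open>(A, S)\<close>.
\<close>

lemma (in Metric_space) generic_radii:
  assumes I: "finite I" "I \<subseteq> M"
    and \<C>: "finite \<C>" "\<Union>\<C> = M" and mesh: "mesh_le \<C> r"
    and r: "0 < r"
    and few: "card \<C> * 2 ^ card I < K ^ Suc n"
  obtains t where "\<And>i. i \<in> I \<Longrightarrow> s \<le> t i \<and> t i + 4 * r \<le> s + 4 * r * real K"
    "\<And>x S. \<lbrakk>x \<in> M; S \<subseteq> I; card S = Suc n\<rbrakk> \<Longrightarrow> \<exists>i\<in>S. r \<le> \<bar>d i x - t i\<bar>"
proof -
  let ?t = "\<lambda>k i. s + 4 * r * real (k i :: nat)"
  let ?\<S> = "{S. S \<subseteq> I \<and> card S = Suc n}"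
  define bad where "bad = (\<lambda>(A, S). {k \<in> I \<rightarrow>\<^sub>E {..<K}. \<exists>x\<in>A. \<forall>i\<in>S. \<bar>d i x - ?t k i\<bar> < r})"
  have K0: "K > 0" using few by (cases K) auto
  have fin\<S>: "finite ?\<S>" using I by auto
  \<comment> \<open>Two values of \<open>d i\<close> on \<open>A\<close> differ by at most \<open>r\<close>, so two radii that are both within \<open>r\<close> of such
    values differ by less than \<open>3 * r\<close>, which is below the spacing of the grid.\<close>
  have card_bad: "card (bad p) \<le> K ^ (card I - Suc n)" if p0: "p \<in> \<C> \<times> ?\<S>" for p
  proof -
    obtain A S where p: "p = (A, S)" "A \<in> \<C>" "S \<subseteq> I" "card S = Suc n"
      using p0 by blast
    have "card (bad p) \<le> K ^ (card I - card S)"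
    proof (rule card_PiE_determined_le[OF I(1) p(3)])
      show "bad p \<subseteq> (I \<rightarrow>\<^sub>E {..<K})" unfolding bad_def p by auto
      fix k k' i assume k: "k \<in> bad p" "k' \<in> bad p" "i \<in> S"
      then obtain x x' where x: "x \<in> A" "x' \<in> A" "\<bar>d i x - ?t k i\<bar> < r" "\<bar>d i x' - ?t k' i\<bar> < r"
        unfolding bad_def p by auto
      have "\<bar>d x i - d i x'\<bar> \<le> d x x'" using \<C>(2) p(2) x k(3) I p(3)
        by (intro mdist_reverse_triangle) auto
      moreover have "d x x' \<le> r" using mesh p(2) x(1,2) unfolding mesh_le_def by blast
      ultimately have "\<bar>d i x - d i x'\<bar> \<le> r" using commute[of x i] by simp
      then have "\<bar>4 * r * real (k i) - 4 * r * real (k' i)\<bar> < 3 * r" using x(3,4) by linarith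
      then have "4 * r * \<bar>real (k i) - real (k' i)\<bar> < 4 * r * 1"
        using r by (simp add: abs_mult flip: right_diff_distrib)
      then have "\<bar>real (k i) - real (k' i)\<bar> < 1" using r by (subst (asm) mult_less_cancel_left_pos) auto
      then show "k i = k' i" by linarith
    qed
    then show ?thesis using p by simp
  qed
  have "\<exists>k \<in> I \<rightarrow>\<^sub>E {..<K}. k \<notin> \<Union>(bad ` (\<C> \<times> ?\<S>))"
  proof (cases "Suc n \<le> card I")
    case True
    have "card (\<Union>(bad ` (\<C> \<times> ?\<S>))) \<le> (\<Sum>p\<in>\<C> \<times> ?\<S>. card (bad p))"
      using \<C>(1) fin\<S> by (intro card_UN_le) auto
    also have "\<dots> \<le> (\<Sum>p\<in>\<C> \<times> ?\<S>. K ^ (card I - Suc n))" by (intro sum_mono card_bad)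
    also have "\<dots> = card \<C> * card ?\<S> * K ^ (card I - Suc n)" by (simp add: card_cartesian_product)
    also have "\<dots> \<le> card \<C> * 2 ^ card I * K ^ (card I - Suc n)"
    proof -
      have "card ?\<S> \<le> card (Pow I)" using I by (intro card_mono) auto
      then show ?thesis using I by (simp add: card_Pow)
    qed
    also have "\<dots> < K ^ Suc n * K ^ (card I - Suc n)" using few K0 by (intro mult_strict_right_mono) auto
    also have "\<dots> = card (I \<rightarrow>\<^sub>E {..<K})"
      using I(1) True by (subst card_PiE) (auto simp del: power_Suc simp flip: power_add)
    finally have less: "card (\<Union>(bad ` (\<C> \<times> ?\<S>))) < card (I \<rightarrow>\<^sub>E {..<K})" .
    have "bad p \<subseteq> I \<rightarrow>\<^sub>E {..<K}" for p unfolding bad_def by (cases p) auto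
    then have "finite (\<Union>(bad ` (\<C> \<times> ?\<S>)))"
      using I(1) by (intro finite_subset[OF _ finite_PiE[of I "\<lambda>_. {..<K}"]]) auto
    then have "\<not> (I \<rightarrow>\<^sub>E {..<K}) \<subseteq> \<Union>(bad ` (\<C> \<times> ?\<S>))"
      using less card_mono by (meson not_less)
    then show ?thesis by (meson subsetI)
  next
    case False
    then have "\<not> (S \<subseteq> I \<and> card S = Suc n)" for S using card_mono[OF I(1), of S] by auto
    then have "?\<S> = {}" by (simp only: Collect_empty_eq simp_thms)
    moreover have "(\<lambda>i\<in>I. 0) \<in> I \<rightarrow>\<^sub>E {..<K}" using K0 by auto
    ultimately show ?thesis 
      by (intro bexI[of _ "\<lambda>i\<in>I. 0"])
        (simp_all only: Sigma_empty2 image_empty Union_empty empty_iff not_False_eq_True)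
  qed
  then obtain k where k0: "k \<in> I \<rightarrow>\<^sub>E {..<K}" "k \<notin> \<Union>(bad ` (\<C> \<times> ?\<S>))" by (elim bexE)
  have k: "k \<notin> bad (A, S)" if "A \<in> \<C>" "S \<in> ?\<S>" for A S
    using k0 that by (auto simp only: UN_iff mem_Sigma_iff)
  show thesis
  proof (rule that[of "?t k"])
    fix i assume "i \<in> I"
    then have "real (k i) + 1 \<le> real K" using k0(1) PiE_mem[of k I "\<lambda>_. {..<K}" i] by fastforce
    then have "4 * r * (real (k i) + 1) \<le> 4 * r * real K" using r by (intro mult_left_mono) auto
    then show "s \<le> ?t k i \<and> ?t k i + 4 * r \<le> s + 4 * r * real K" using r by (simp add: algebra_simps)
  next
    fix x S assume x: "x \<in> M" "S \<subseteq> I" "card S = Suc n"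
    then obtain A where "A \<in> \<C>" "x \<in> A" using \<C>(2) by blast
    then have "k \<notin> bad (A, S)" using k x(2,3) by blast
    then have "\<not> (\<forall>i\<in>S. \<bar>d i x - ?t k i\<bar> < r)"
      using k0(1) \<open>x \<in> A\<close> unfolding bad_def by blast
    then show "\<exists>i\<in>S. r \<le> \<bar>d i x - ?t k i\<bar>" by (simp add: not_less)
  qed
qed

text \<open>
  The hypothesis holds in particular if the lower box dimension is below \<open>n + 1\<close>.  The refinement consists of the balls of generic radius around a
  net, enlarged by \<open>r\<close>, minus the earlier balls shrunk by \<open>r\<close>.  A point common to several
  of these pieces is \<open>r\<close>-close to the sphere of each of them except the last, and generically this happens for
  at most \<open>n\<close> spheres.
\<close>

lemma (in Metric_space) covering_dim_le_if_few_small_sets: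
  assumes comp: "compact_space mtopology"
    and box: "\<And>c. 0 < c \<Longrightarrow> \<exists>r \<C>. 0 < r \<and> r \<le> c \<and> finite \<C> \<and> \<Union>\<C> = M \<and>
       mesh_le \<C> r \<and> real (card \<C>) * r ^ Suc n < c"
  shows "covering_dim_le mtopology n"
  unfolding covering_dim_le_def
proof (intro allI impI)
  fix \<U> assume "open_cover mtopology \<U>"
  then obtain \<rho> where \<rho>: "0 < \<rho>" "\<And>x. x \<in> M \<Longrightarrow> \<exists>U\<in>\<U>. mball x \<rho> \<subseteq> U"
    using Lebesgue_number[OF comp] by blast
  define s where "s = \<rho> / 2"
  have s: "s > 0" "\<rho> = 2 * s" using \<rho> by (auto simp: s_def)
  obtain I where I: "finite I" "I \<subseteq> M" "M \<subseteq> (\<Union>x\<in>I. mball x s)" using finite_net[OF comp s(1)] .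
  \<comment> \<open>The bound \<open>s / 4\<close> leaves room for at least one radius between \<open>s\<close> and \<open>2 * s\<close>; the other bound makes
    the number \<open>K\<close> of radii, which is at least \<open>s / (8 * r)\<close>, large enough for the count.\<close>
  define c where "c = min (s / 4) ((s / 8) ^ Suc n / 2 ^ card I)"
  have "c > 0" using s by (auto simp: c_def)
  from box[OF this] obtain r \<C> where r: "0 < r" "r \<le> c" and \<C>: "finite \<C>" "\<Union>\<C> = M"
    and mesh: "mesh_le \<C> r" and few: "real (card \<C>) * r ^ Suc n < c"
    by (elim exE conjE) (rule that)
  define K where "K = nat \<lfloor>s / (4 * r)\<rfloor>"
  have rs: "1 \<le> s / (4 * r)" using r by (auto simp: c_def field_simps)
  have K_le: "real K \<le> s / (4 * r)" unfolding K_def using rs by linarith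
  then have K_le': "4 * r * real K \<le> s" using r by (simp add: field_simps)
  have K_ge: "s / (8 * r) \<le> real K"
  proof -
    define u where "u = s / (8 * r)"
    have u: "s / (4 * r) = 2 * u" unfolding u_def by simp
    then have "1 \<le> \<lfloor>2 * u\<rfloor>" using rs by simp
    then show ?thesis unfolding K_def u u_def[symmetric] by linarith
  qed
  have "card \<C> * 2 ^ card I < K ^ Suc n"
  proof -
    have "real (card \<C>) * r ^ Suc n * 2 ^ card I < (s / 8) ^ Suc n"
      using few unfolding c_def by (simp add: pos_less_divide_eq del: power_Suc)
    then have "real (card \<C>) * 2 ^ card I < (s / 8) ^ Suc n / r ^ Suc n"
      using r by (simp add: pos_less_divide_eq mult_ac)
    also have "\<dots> = (s / (8 * r)) ^ Suc n" by (simp add: power_divide power_mult_distrib)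
    also have "\<dots> \<le> real K ^ Suc n" using s r K_ge by (intro power_mono) auto
    finally have "real (card \<C> * 2 ^ card I) < real (K ^ Suc n)" by simp
    then show ?thesis by (simp only: of_nat_less_iff)
  qed
  then obtain t where
    t: "\<And>i. i \<in> I \<Longrightarrow> s \<le> t i \<and> t i + 4 * r \<le> s + 4 * r * real K"
    and gen: "\<And>x S. \<lbrakk>x \<in> M; S \<subseteq> I; card S = Suc n\<rbrakk> \<Longrightarrow> \<exists>i\<in>S. r \<le> \<bar>d i x - t i\<bar>"
    by (rule generic_radii[OF I(1,2) \<C> mesh r(1)]) (rule that)
  obtain e where e: "bij_betw e {..<card I} I"
    using that[OF bij_betw_from_nat_into_finite[OF I(1)]] .
  have eI: "e a \<in> I" if "a < card I" for a using e that by (auto simp: bij_betw_def)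
  define V where "V = (\<lambda>a. {x\<in>M. d (e a) x < t (e a) + r \<and> (\<forall>b<a. t (e b) - r < d (e b) x)})"
  have opV: "openin mtopology (V a)" if a: "a < card I" for a
    unfolding openin_mtopology
  proof (intro conjI allI impI)
    fix x assume x: "x \<in> V a"
    define T where "T = insert (t (e a) + r - d (e a) x) ((\<lambda>b. d (e b) x - (t (e b) - r)) ` {..<a})"
    have "Min T > 0" using x unfolding T_def V_def by (subst Min_gr_iff) auto
    moreover have "mball x (Min T) \<subseteq> V a"
    proof
      fix y assume y: "y \<in> mball x (Min T)"
      have "finite T" by (simp add: T_def)
      then have near: "d x y < u" if "u \<in> T" for u using y Min_le[OF _ that] by auto
      have close: "\<bar>d (e b) x - d (e b) y\<bar> \<le> d x y" if "b \<le> a" for b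
        using mdist_reverse_triangle[of x "e b" y] eI[of b] I(2) x y that a commute[of x "e b"]
        by (auto simp: V_def)
      have "d (e a) y < t (e a) + r" using near[of "t (e a) + r - d (e a) x"] close[of a] by (auto simp: T_def)
      moreover have "t (e b) - r < d (e b) y" if "b < a" for b
        using near[of "d (e b) x - (t (e b) - r)"] close[of b] that by (auto simp: T_def)
      ultimately show "y \<in> V a" using y unfolding V_def by auto
    qed
    ultimately show "\<exists>r>0. mball x r \<subseteq> V a" by blast
  qed (auto simp: V_def)
  let ?\<V> = "V ` {..<card I}"
  have cov: "\<Union>?\<V> = M"
  proof
    show "M \<subseteq> \<Union>?\<V>"
    proof
      fix x assume x: "x \<in> M"
      then obtain i where i: "i \<in> I" "d i x < s" using I(3) by auto
      then obtain a0 where a0: "a0 < card I" "e a0 = i"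
        using bij_betw_imp_surj_on[OF e] by (metis imageE lessThan_iff)
      define P where "P = (\<lambda>a. a < card I \<and> d (e a) x < t (e a))"
      have P: "P a0" using a0 i t[of i] by (auto simp: P_def)
      let ?a = "LEAST a. P a"
      have a: "P ?a" using P by (rule LeastI)
      have "\<not> P b" if "b < ?a" for b using that by (rule not_less_Least)
      then have "t (e b) \<le> d (e b) x" if "b < ?a" for b
        using that a unfolding P_def by (meson less_trans not_less)
      then have "t (e b) - r < d (e b) x" if "b < ?a" for b using that r(1) by fastforce
      moreover have "d (e ?a) x < t (e ?a) + r" using a r(1) by (auto simp: P_def)
      ultimately have "x \<in> V ?a" using x unfolding V_def by blast
      then show "x \<in> \<Union>?\<V>" using a unfolding P_def by blast
    qed
  qed (auto simp: V_def)
  show "\<exists>\<V>. open_cover mtopology \<V> \<and> refines \<V> \<U> \<and>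
      (\<forall>x\<in>topspace mtopology. finite {V\<in>\<V>. x \<in> V} \<and> card {V\<in>\<V>. x \<in> V} \<le> n + 1)"
  proof (intro exI[of _ ?\<V>] conjI ballI)
    show "open_cover mtopology ?\<V>" using opV cov by (auto simp: open_cover_def)
    show "refines ?\<V> \<U>"
      unfolding refines_def
    proof
      fix W assume "W \<in> ?\<V>"
      then obtain a where a: "a < card I" "W = V a" by auto
      have "W \<subseteq> mball (e a) \<rho>"
        using t[OF eI[OF a(1)]] K_le' r(1) s(2) eI[OF a(1)] I(2) a(2) by (auto simp: V_def)
      moreover have "e a \<in> M" using eI[OF a(1)] I(2) by blast
      ultimately show "\<exists>U\<in>\<U>. W \<subseteq> U" using \<rho>(2) by (meson order_trans)
    qed
    fix x assume "x \<in> topspace mtopology"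
    then have x: "x \<in> M" by simp
    define J where "J = {a. a < card I \<and> x \<in> V a}"
    have J: "finite J" by (auto simp: J_def)
    have sub: "{W\<in>?\<V>. x \<in> W} \<subseteq> V ` J" by (auto simp: J_def)
    then show "finite {W\<in>?\<V>. x \<in> W}" by (rule finite_subset) (use J in simp)
    have "card J \<le> n + 1"
    proof (rule ccontr)
      assume "\<not> card J \<le> n + 1"
      then have J2: "Suc n \<le> card (J - {Max J})" "J \<noteq> {}" using J by (auto simp: card_Diff_singleton_if)
      obtain J' where J': "J' \<subseteq> J - {Max J}" "card J' = Suc n"
        using obtain_subset_with_card_n[OF J2(1)] by metis
      have inj: "inj_on e J'"
        using e J' by (auto simp: bij_betw_def J_def intro: inj_on_subset)
      have "e ` J' \<subseteq> I" using J' eI by (auto simp: J_def)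
      moreover have "card (e ` J') = Suc n" using inj J' by (simp add: card_image)
      ultimately obtain b where b: "b \<in> J'" "r \<le> \<bar>d (e b) x - t (e b)\<bar>"
        using gen[OF x, of "e ` J'"] by blast
      \<comment> \<open>The later piece \<open>V (Max J)\<close> keeps \<open>x\<close> outside the shrunken ball number \<open>b\<close>, while \<open>V b\<close>
        keeps it inside the enlarged one.\<close>
      have "b < Max J" using b(1) J'(1) Max_ge[OF J, of b] by (auto simp: order_less_le)
      moreover have "Max J \<in> J" using J J2 by auto
      ultimately have "t (e b) - r < d (e b) x" unfolding J_def V_def by blast
      moreover have "d (e b) x < t (e b) + r" using b(1) J'(1) unfolding J_def V_def by blast
      ultimately show False using b(2) by linarith
    qed
    then show "card {W\<in>?\<V>. x \<in> W} \<le> n + 1"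
      using card_mono[OF _ sub] card_image_le[OF J, of V] J by force
  qed
qed

section \<open>Cover numbers of joins\<close>

lemma cover_number_le:
  assumes "\<C> \<subseteq> \<U>" "finite \<C>" "topspace T \<subseteq> \<Union>\<C>"
  shows "cover_number T \<U> \<le> card \<C>"
  unfolding cover_number_def using assms by (intro Least_le) blast

lemma cover_number_attained:
  assumes "compact_space T" "open_cover T \<U>"
  obtains \<C> where "\<C> \<subseteq> \<U>" "finite \<C>" "topspace T \<subseteq> \<Union>\<C>" "card \<C> = cover_number T \<U>"
proof -
  have "\<exists>\<C>. finite \<C> \<and> \<C> \<subseteq> \<U> \<and> topspace T \<subseteq> \<Union>\<C>"
  proof (rule compactinD)
    show "compactin T (topspace T)" using assms(1) by (simp add: compact_space_def)
  qed (use assms(2) in \<open>auto simp: open_cover_def\<close>)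
  then have "\<exists>k. \<exists>\<C>\<subseteq>\<U>. finite \<C> \<and> topspace T \<subseteq> \<Union>\<C> \<and> card \<C> = k" by blast
  from LeastI_ex[OF this] show thesis using that unfolding cover_number_def by blast
qed

lemma cover_number_pos:
  assumes "compact_space T" "open_cover T \<U>" "topspace T \<noteq> {}"
  shows "0 < cover_number T \<U>"
proof -
  obtain \<C> where \<C>: "finite \<C>" "topspace T \<subseteq> \<Union>\<C>" "card \<C> = cover_number T \<U>"
    using cover_number_attained[OF assms(1,2)] by metis
  then have "\<C> \<noteq> {}" using assms(3) by blast
  then show ?thesis using \<C> by (simp add: card_gt_0_iff flip: \<C>(3))
qed

lemma cover_number_le_if_refines:
  assumes "finite \<C>" "topspace T \<subseteq> \<Union>\<C>" "refines \<C> \<U>"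
  shows "cover_number T \<U> \<le> card \<C>"
proof -
  obtain u where u: "\<And>C. C \<in> \<C> \<Longrightarrow> u C \<in> \<U> \<and> C \<subseteq> u C"
    using assms(3) unfolding refines_def by metis
  have "cover_number T \<U> \<le> card (u ` \<C>)"
  proof (rule cover_number_le)
    show "topspace T \<subseteq> \<Union>(u ` \<C>)" using assms(2) u by blast
  qed (use u assms(1) in auto)
  also have "\<dots> \<le> card \<C>" by (rule card_image_le[OF assms(1)])
  finally show ?thesis .
qed

lemma continuous_map_funpow:
  "continuous_map T T f \<Longrightarrow> continuous_map T T (f ^^ n)"
  by (induction n) (auto simp: continuous_map_compose id_def[symmetric])

lemma open_cover_cover_join:
  assumes f: "continuous_map T T f" and \<U>: "open_cover T \<U>"
  shows "open_cover T (cover_join T f \<U> n)"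
  unfolding open_cover_def
proof (intro conjI ballI)
  fix C assume "C \<in> cover_join T f \<U> n"
  then obtain W where W: "\<forall>i<n. W i \<in> \<U>" "C = {x \<in> topspace T. \<forall>i<n. (f ^^ i) x \<in> W i}"
    unfolding cover_join_def by blast
  have "openin T {x \<in> topspace T. \<forall>i<m. (f ^^ i) x \<in> W i}" if "m \<le> n" for m
    using that
  proof (induction m)
    case (Suc m)
    have eq: "{x \<in> topspace T. \<forall>i<Suc m. (f ^^ i) x \<in> W i} =
        {x \<in> topspace T. \<forall>i<m. (f ^^ i) x \<in> W i} \<inter> {x \<in> topspace T. (f ^^ m) x \<in> W m}"
      by (auto simp: less_Suc_eq)
    have "openin T (W m)" using W(1) \<U> Suc.prems unfolding open_cover_def by auto
    then show ?case unfolding eq using Suc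
      by (intro openin_Int openin_continuous_map_preimage[OF continuous_map_funpow[OF f]]) auto
  qed simp
  then show "openin T C" using W(2) by simp
next
  show "\<Union>(cover_join T f \<U> n) = topspace T"
  proof
    show "topspace T \<subseteq> \<Union>(cover_join T f \<U> n)"
    proof
      fix x assume x: "x \<in> topspace T"
      have "(f ^^ i) x \<in> \<Union>\<U>" for i
        using continuous_map_funspace[OF continuous_map_funpow[OF f, of i]] x \<U>
        unfolding open_cover_def by auto
      then have "\<exists>W. W \<in> \<U> \<and> (f ^^ i) x \<in> W" for i by blast
      then obtain W where "\<And>i. W i \<in> \<U> \<and> (f ^^ i) x \<in> W i" by metis
      then show "x \<in> \<Union>(cover_join T f \<U> n)" using x unfolding cover_join_def by blast
    qed
  qed (auto simp: cover_join_def)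
qed

lemma cover_number_cover_join_le:
  assumes f: "continuous_map T T f" and \<U>: "open_cover T \<U>" "finite \<U>"
  shows "cover_number T (cover_join T f \<U> n) \<le> card \<U> ^ n"
proof -
  let ?c = "\<lambda>W. {x \<in> topspace T. \<forall>i<n. (f ^^ i) x \<in> W i}"
  have sub: "cover_join T f \<U> n \<subseteq> ?c ` ({..<n} \<rightarrow>\<^sub>E \<U>)"
  proof
    fix C assume "C \<in> cover_join T f \<U> n"
    then obtain W where W: "\<forall>i<n. W i \<in> \<U>" "C = ?c W" unfolding cover_join_def by blast
    have "C = ?c (restrict W {..<n})" unfolding W(2) by auto
    moreover have "restrict W {..<n} \<in> {..<n} \<rightarrow>\<^sub>E \<U>" using W(1) by (simp add: restrict_PiE_iff)
    ultimately show "C \<in> ?c ` ({..<n} \<rightarrow>\<^sub>E \<U>)" by blast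
  qed
  have fin: "finite ({..<n} \<rightarrow>\<^sub>E \<U>)" using \<U>(2) by (intro finite_PiE) auto
  have "cover_number T (cover_join T f \<U> n) \<le> card (cover_join T f \<U> n)"
  proof (rule cover_number_le)
    show "finite (cover_join T f \<U> n)" using sub fin by (meson finite_imageI finite_subset)
    show "topspace T \<subseteq> \<Union>(cover_join T f \<U> n)"
      using open_cover_cover_join[OF f \<U>(1), of n] by (simp add: open_cover_def)
  qed simp
  also have "\<dots> \<le> card (?c ` ({..<n} \<rightarrow>\<^sub>E \<U>))" using sub fin by (intro card_mono) auto
  also have "\<dots> \<le> card ({..<n} \<rightarrow>\<^sub>E \<U>)" by (rule card_image_le[OF fin])
  also have "\<dots> = card \<U> ^ n" by (simp add: card_PiE)
  finally show ?thesis .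
qed

lemma (in Metric_space) finite_small_cover:
  assumes "compact_space mtopology" "0 < r"
  obtains \<A> where "open_cover mtopology \<A>" "finite \<A>"
    "mesh_le \<A> r"
proof -
  obtain K where K: "finite K" "K \<subseteq> M" "M \<subseteq> (\<Union>x\<in>K. mball x (r / 2))"
    using finite_net[OF assms(1), of "r / 2"] assms(2) by (metis half_gt_zero)
  show thesis
  proof (rule that)
    show "open_cover mtopology ((\<lambda>x. mball x (r / 2)) ` K)"
      using K(2,3) unfolding open_cover_def by auto
    show "finite ((\<lambda>x. mball x (r / 2)) ` K)" using K(1) by simp
    show "mesh_le ((\<lambda>x. mball x (r / 2)) ` K) r"
      unfolding mesh_le_def
    proof (intro ballI)
      fix A x y assume "A \<in> (\<lambda>x. mball x (r / 2)) ` K" "x \<in> A" "y \<in> A"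
      then obtain z where "z \<in> M" "x \<in> M" "y \<in> M" "d z x < r / 2" "d z y < r / 2" by auto
      then show "d x y \<le> r" using triangle''[of x z y] by simp
    qed
  qed
qed

section \<open>Orbits that stay close are exponentially close in the middle\<close>

context smale_space
begin

lemma phi_continuous: "continuous_map mtopology mtopology \<phi>"
  using homeo by (rule homeomorphic_imp_continuous_map)

lemma phi_image: "\<phi> ` M = M" and phi_inj: "inj_on \<phi> M"
  using homeo unfolding homeomorphic_eq_everything_map by auto

lemma funpow_image: "(\<phi> ^^ n) ` M = M"
proof (induction n)
  case (Suc n)
  have "(\<phi> ^^ Suc n) ` M = \<phi> ` (\<phi> ^^ n) ` M" by (simp add: image_comp)
  then show ?case using Suc phi_image by simp
qed simp

lemma funpow_in_M: "x \<in> M \<Longrightarrow> (\<phi> ^^ n) x \<in> M"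
  using funpow_image by blast

lemma nonempty: "M \<noteq> {}"
  using infinite_carrier by auto

lemma bracket_in_M: "\<lbrakk>x \<in> M; y \<in> M; d x y \<le> eps\<rbrakk> \<Longrightarrow> br x y \<in> M"
  using funcset_mem[OF continuous_map_funspace[OF bracket_continuous], of "(x, y)"] by auto

text \<open>
  Uniform continuity of the bracket on the diagonal, where it is the identity; a Lebesgue number of a cover
  by balls on which it is nearly constant gives the uniform scale.
\<close>

lemma bracket_near_diagonal:
  assumes "0 < \<eta>"
  obtains \<delta> where "0 < \<delta>" "\<delta> \<le> eps"
    "\<And>x y. \<lbrakk>x \<in> M; y \<in> M; d x y \<le> \<delta>\<rbrakk> \<Longrightarrow> d x (br x y) < \<eta> \<and> d (br x y) y < \<eta>"
proof -
  let ?D = "{(x, y). x \<in> M \<and> y \<in> M \<and> d x y \<le> eps}"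
  let ?good = "\<lambda>p r. 0 < r \<and> r \<le> \<eta> / 2 \<and>
    (\<forall>x\<in>mball p r. \<forall>y\<in>mball p r. d x y \<le> eps \<longrightarrow> d p (br x y) < \<eta> / 2)"
  have "\<exists>r. ?good p r" if p: "p \<in> M" for p
  proof -
    let ?S = "{z \<in> topspace (subtopology (prod_topology mtopology mtopology) ?D).
      (\<lambda>(x, y). br x y) z \<in> mball p (\<eta> / 2)}"
    have "openin (subtopology (prod_topology mtopology mtopology) ?D) ?S"
      by (rule openin_continuous_map_preimage[OF bracket_continuous openin_mball])
    then obtain Q where Q: "openin (prod_topology mtopology mtopology) Q" "?S = Q \<inter> ?D"
      unfolding openin_subtopology by blast
    have "(p, p) \<in> ?S" using p assms eps_pos bracket_same by auto
    then have "(p, p) \<in> Q" using Q(2) by blast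
    then obtain U V where UV: "openin mtopology U" "openin mtopology V" "p \<in> U" "p \<in> V" "U \<times> V \<subseteq> Q"
      using Q(1)[unfolded openin_prod_topology_alt, rule_format, of p p] by (elim meta_impE exE conjE)
    obtain r1 where r1: "r1 > 0" "mball p r1 \<subseteq> U" using UV(1,3) unfolding openin_mtopology by metis
    obtain r2 where r2: "r2 > 0" "mball p r2 \<subseteq> V" using UV(2,4) unfolding openin_mtopology by metis
    note r = r1 r2
    have "?good p (min (\<eta> / 2) (min r1 r2))"
    proof (intro conjI ballI impI)
      fix x y assume xy: "x \<in> mball p (min (\<eta> / 2) (min r1 r2))"
        "y \<in> mball p (min (\<eta> / 2) (min r1 r2))" "d x y \<le> eps"
      then have "x \<in> U" "y \<in> V" using r by auto
      then have "(x, y) \<in> ?S" using xy UV(5) unfolding Q(2) by auto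
      then show "d p (br x y) < \<eta> / 2" by auto
    qed (use r assms in auto)
    then show ?thesis by blast
  qed
  then obtain r where r: "\<And>p. p \<in> M \<Longrightarrow> ?good p (r p)" by metis
  have "open_cover mtopology ((\<lambda>p. mball p (r p)) ` M)"
    using r unfolding open_cover_def by auto
  from Lebesgue_number[OF compact this] obtain \<rho> where \<rho>: "0 < \<rho>"
    "\<And>x. x \<in> M \<Longrightarrow> \<exists>U\<in>(\<lambda>p. mball p (r p)) ` M. mball x \<rho> \<subseteq> U" by blast
  show thesis
  proof (rule that[of "min eps (\<rho> / 2)"])
    show "0 < min eps (\<rho> / 2)" using \<rho> eps_pos by simp
    fix x y assume xy: "x \<in> M" "y \<in> M" "d x y \<le> min eps (\<rho> / 2)"
    obtain p where p: "p \<in> M" "mball x \<rho> \<subseteq> mball p (r p)" using \<rho>(2)[OF xy(1)] by blast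
    have "x \<in> mball x \<rho>" "y \<in> mball x \<rho>" using xy \<rho>(1) by auto
    then have in_p: "x \<in> mball p (r p)" "y \<in> mball p (r p)" using p(2) by blast+
    have b: "d p (br x y) < \<eta> / 2" using r[OF p(1)] in_p xy(3) by auto
    have bM: "br x y \<in> M" using bracket_in_M xy by auto
    have "d p x < \<eta> / 2" "d p y < \<eta> / 2" using in_p r[OF p(1)] by auto
    then show "d x (br x y) < \<eta> \<and> d (br x y) y < \<eta>"
      using b triangle''[OF xy(1) p(1) bM] triangle''[OF bM p(1) xy(2)] by auto
  qed auto
qed

text \<open>
  The two-sided estimate \<open>d(\<phi>\<^sup>i x, \<phi>\<^sup>i y) \<le> \<delta>\<close> for \<open>\<bar>i\<bar> \<le> n\<close> implies \<open>d(x, y) \<le> 2 eps lam\<^sup>-\<^sup>n\<close>, shifted by \<open>n\<close>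
  steps so that only forward iterates of \<open>\<phi>\<close> occur, as they do in \<open>cover_join\<close>.  In particular
  \<open>\<delta>\<close> is an expansivity constant.
\<close>

definition tracking_scale :: "real \<Rightarrow> bool" where
  "tracking_scale \<delta> \<longleftrightarrow> (\<forall>x\<in>M. \<forall>y\<in>M. \<forall>n.
     (\<forall>i\<le>2 * n. d ((\<phi> ^^ i) x) ((\<phi> ^^ i) y) \<le> \<delta>) \<longrightarrow>
     d ((\<phi> ^^ n) x) ((\<phi> ^^ n) y) \<le> 2 * eps * inverse lam ^ n)"

lemma tracking_scaleD:
  "\<lbrakk>tracking_scale \<delta>; x \<in> M; y \<in> M; \<And>i. i \<le> 2 * n \<Longrightarrow> d ((\<phi> ^^ i) x) ((\<phi> ^^ i) y) \<le> \<delta>\<rbrakk>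
    \<Longrightarrow> d ((\<phi> ^^ n) x) ((\<phi> ^^ n) y) \<le> 2 * eps * inverse lam ^ n"
  unfolding tracking_scale_def by blast

text \<open>
  By equivariance the point \<open>Z i\<close> remains the bracket of \<open>X i\<close> and \<open>Y i\<close> as long as these are close, so it
  lies in the local stable set of \<open>X i\<close> and in the local unstable set of \<open>Y i\<close> throughout.  Contracting from
  time \<open>0\<close> up to \<open>n\<close> and from time \<open>2 * n\<close> down to \<open>n\<close> bounds both distances at time \<open>n\<close>.
\<close>

lemma exponential_tracking:
  obtains \<delta> where "0 < \<delta>"
    "tracking_scale \<delta>"
proof -
  obtain \<delta> where \<delta>: "0 < \<delta>" "\<delta> \<le> eps" and near:
    "\<And>x y. \<lbrakk>x \<in> M; y \<in> M; d x y \<le> \<delta>\<rbrakk> \<Longrightarrow> d x (br x y) < eps \<and> d (br x y) y < eps"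
    using bracket_near_diagonal[OF eps_pos] by blast
  show thesis
  proof (rule that[OF \<delta>(1)], unfold tracking_scale_def, intro ballI allI impI)
    fix x y n
    assume xy: "x \<in> M" "y \<in> M" and close: "\<forall>i\<le>2 * n. d ((\<phi> ^^ i) x) ((\<phi> ^^ i) y) \<le> \<delta>"
    define X Y Z where "X = (\<lambda>i. (\<phi> ^^ i) x)" and "Y = (\<lambda>i. (\<phi> ^^ i) y)" and "Z = (\<lambda>i. (\<phi> ^^ i) (br x y))"
    have Suc: "X (Suc i) = \<phi> (X i)" "Y (Suc i) = \<phi> (Y i)" "Z (Suc i) = \<phi> (Z i)" for i
      by (auto simp: X_def Y_def Z_def)
    have XY: "X i \<in> M" "Y i \<in> M" for i using xy funpow_in_M by (auto simp: X_def Y_def)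
    have dXY: "d (X i) (Y i) \<le> \<delta>" if "i \<le> 2 * n" for i using close that by (simp add: X_def Y_def)
    then have dXY': "d (X i) (Y i) \<le> eps" if "i \<le> 2 * n" for i using that \<delta>(2) by fastforce
    have Z: "Z i = br (X i) (Y i)" if "i \<le> 2 * n" for i
      using that
    proof (induction i)
      case (Suc i)
      have "Z (Suc i) = \<phi> (br (X i) (Y i))" using Suc by (simp add: \<open>Z (Suc i) = \<phi> (Z i)\<close>)
      also have "\<dots> = br (\<phi> (X i)) (\<phi> (Y i))"
        using Suc.prems dXY'[of i] dXY'[of "Suc i"] XY
        by (intro bracket_equivariant) (auto simp: \<open>X (Suc i) = \<phi> (X i)\<close> \<open>Y (Suc i) = \<phi> (Y i)\<close>)
      finally show ?case by (simp add: \<open>X (Suc i) = \<phi> (X i)\<close> \<open>Y (Suc i) = \<phi> (Y i)\<close>)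
    qed (simp add: X_def Y_def Z_def)
    have ZM: "Z i \<in> M" if "i \<le> 2 * n" for i using Z[OF that] bracket_in_M XY dXY'[OF that] by simp
    have nearZ: "d (X i) (Z i) < eps" "d (Z i) (Y i) < eps" if "i \<le> 2 * n" for i
      using near[OF XY dXY[OF that]] Z[OF that] by auto
    have stable: "d (X (Suc i)) (Z (Suc i)) \<le> inverse lam * d (X i) (Z i)" if i: "i \<le> 2 * n" for i
      unfolding Suc
    proof (rule stable_contraction)
      show "X i \<in> M" "0 < eps" "eps \<le> eps" using XY eps_pos by auto
      show "X i \<in> local_stable M d br (X i) eps"
        using XY eps_pos bracket_same by (auto simp: local_stable_def)
      have "br (X i) (Z i) = Z i"
        unfolding Z[OF i] using bracket_right[of "X i" "X i" "Y i"] XY dXY'[OF i] nearZ[OF i] Z[OF i] by auto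
      then show "Z i \<in> local_stable M d br (X i) eps"
        using ZM[OF i] nearZ[OF i] by (auto simp: local_stable_def)
    qed
    have unstable: "d (Y i) (Z i) \<le> inverse lam * d (Y (Suc i)) (Z (Suc i))" if i: "Suc i \<le> 2 * n" for i
    proof -
      have "d (inv_into M \<phi> (Y (Suc i))) (inv_into M \<phi> (Z (Suc i))) \<le> inverse lam * d (Y (Suc i)) (Z (Suc i))"
      proof (rule unstable_contraction)
        show "Y (Suc i) \<in> M" "0 < eps" "eps \<le> eps" using XY eps_pos by auto
        show "Y (Suc i) \<in> local_unstable M d br (Y (Suc i)) eps"
          using XY eps_pos bracket_same by (auto simp: local_unstable_def)
        have "br (Z (Suc i)) (Y (Suc i)) = Z (Suc i)"
          unfolding Z[OF i] using bracket_left[of "X (Suc i)" "Y (Suc i)" "Y (Suc i)"] XY dXY'[OF i]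
            nearZ[OF i] Z[OF i] by auto
        then show "Z (Suc i) \<in> local_unstable M d br (Y (Suc i)) eps"
          using ZM[OF i] nearZ[OF i] commute[of "Y (Suc i)"] by (auto simp: local_unstable_def)
      qed
      moreover have "Z i \<in> M" using ZM i by simp
      ultimately show ?thesis unfolding Suc using XY phi_inj by simp
    qed
    have mu: "0 \<le> inverse lam" using lam_gt_1 by simp
    have "d (X i) (Z i) \<le> inverse lam ^ i * eps" if "i \<le> 2 * n" for i
      using that
    proof (induction i)
      case 0
      then show ?case using nearZ(1)[of 0] by simp
    next
      case (Suc i)
      have "d (X (Suc i)) (Z (Suc i)) \<le> inverse lam * d (X i) (Z i)" using stable[of i] Suc.prems by simp
      also have "\<dots> \<le> inverse lam * (inverse lam ^ i * eps)" using Suc mu by (intro mult_left_mono) auto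
      finally show ?case by (simp add: mult_ac)
    qed
    then have "d (X n) (Z n) \<le> inverse lam ^ n * eps" by simp
    moreover have "d (Y (2 * n - j)) (Z (2 * n - j)) \<le> inverse lam ^ j * eps" if "j \<le> 2 * n" for j
      using that
    proof (induction j)
      case 0
      then show ?case using nearZ(2)[of "2 * n"] commute[of "Y (2 * n)"] by simp
    next
      case (Suc j)
      have eq: "Suc (2 * n - Suc j) = 2 * n - j" using Suc.prems by simp
      have "d (Y (2 * n - Suc j)) (Z (2 * n - Suc j)) \<le> inverse lam * d (Y (2 * n - j)) (Z (2 * n - j))"
        using unstable[of "2 * n - Suc j"] unfolding eq by simp
      also have "\<dots> \<le> inverse lam * (inverse lam ^ j * eps)" using Suc mu by (intro mult_left_mono) auto
      finally show ?case by (simp add: mult_ac)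
    qed
    from this[of n] have "d (Y n) (Z n) \<le> inverse lam ^ n * eps" by (simp add: mult_2)
    moreover have "d (X n) (Y n) \<le> d (X n) (Z n) + d (Y n) (Z n)"
      using XY ZM[of n] by (intro triangle') auto
    ultimately show "d ((\<phi> ^^ n) x) ((\<phi> ^^ n) y) \<le> 2 * eps * inverse lam ^ n"
      unfolding X_def Y_def by (simp add: mult_ac)
  qed
qed

section \<open>Entropy bounds the dimension\<close>

lemma minimal_join_subcover:
  assumes "open_cover mtopology \<U>"
  obtains \<C> where "\<C> \<subseteq> cover_join mtopology \<phi> \<U> n" "finite \<C>" "M \<subseteq> \<Union>\<C>"
    "card \<C> = cover_number mtopology (cover_join mtopology \<phi> \<U> n)"
  using cover_number_attained[OF compact open_cover_cover_join[OF phi_continuous assms, of n]]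
  unfolding topspace_mtopology .

lemma join_tracking:
  assumes \<delta>: "tracking_scale \<delta>"
    and \<A>: "mesh_le \<A> \<delta>"
    and C: "C \<in> cover_join mtopology \<phi> \<A> n" "x \<in> C" "y \<in> C" and k: "j + 2 * k < n"
  shows "d ((\<phi> ^^ (k + j)) x) ((\<phi> ^^ (k + j)) y) \<le> 2 * eps * inverse lam ^ k"
proof -
  obtain W where W: "\<forall>i<n. W i \<in> \<A>" "C = {x \<in> M. \<forall>i<n. (\<phi> ^^ i) x \<in> W i}"
    using C(1) unfolding cover_join_def by auto
  have "d ((\<phi> ^^ k) ((\<phi> ^^ j) x)) ((\<phi> ^^ k) ((\<phi> ^^ j) y)) \<le> 2 * eps * inverse lam ^ k"
  proof (rule tracking_scaleD[OF \<delta>])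
    show "(\<phi> ^^ j) x \<in> M" "(\<phi> ^^ j) y \<in> M" using C(2,3) W(2) funpow_in_M by auto
    fix i assume "i \<le> 2 * k"
    then have "i + j < n" using k by simp
    then have "W (i + j) \<in> \<A>" "(\<phi> ^^ (i + j)) x \<in> W (i + j)" "(\<phi> ^^ (i + j)) y \<in> W (i + j)"
      using C(2,3) W by auto
    then show "d ((\<phi> ^^ i) ((\<phi> ^^ j) x)) ((\<phi> ^^ i) ((\<phi> ^^ j) y)) \<le> \<delta>"
      using \<A> by (simp add: mesh_le_def funpow_add)
  qed
  then show ?thesis by (simp add: funpow_add)
qed

lemma inverse_power_small:
  assumes "0 < c"
  obtains k where "2 * eps * inverse lam ^ k < c"
proof -
  have "0 < c / (2 * eps)" "inverse lam < 1" using assms eps_pos lam_gt_1 by (auto simp: inverse_less_1_iff)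
  then obtain k where "inverse lam ^ k < c / (2 * eps)" using real_arch_pow_inv by blast
  then show thesis using that[of k] eps_pos by (simp add: field_simps)
qed

text \<open>
  A cover whose mesh is a tracking scale is a generator: images under \<open>\<phi>\<^sup>k\<close> of cylinders of length
  \<open>2 * k + 1\<close> are smaller than a Lebesgue number of \<open>\<U>\<close>.  Hence the image under \<open>\<phi>\<^sup>k\<close> of a cylinder of length
  \<open>n + 2 * k\<close> lies in a member of the \<open>n\<close>-fold join of \<open>\<U>\<close>.
\<close>

lemma cover_number_join_le_generator:
  assumes \<delta>: "tracking_scale \<delta>"
    and \<A>: "open_cover mtopology \<A>" "mesh_le \<A> \<delta>"
    and \<U>: "open_cover mtopology \<U>"
  obtains k where "\<forall>n. cover_number mtopology (cover_join mtopology \<phi> \<U> n) \<le>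
    cover_number mtopology (cover_join mtopology \<phi> \<A> (n + 2 * k))"
proof -
  obtain \<rho> where \<rho>: "0 < \<rho>" "\<And>x. x \<in> M \<Longrightarrow> \<exists>U\<in>\<U>. mball x \<rho> \<subseteq> U"
    using Lebesgue_number[OF compact \<U>] by blast
  obtain k where k: "2 * eps * inverse lam ^ k < \<rho>" using inverse_power_small[OF \<rho>(1)] .
  show thesis
  proof (rule that, rule allI)
    fix n
    obtain \<C> where \<C>: "\<C> \<subseteq> cover_join mtopology \<phi> \<A> (n + 2 * k)" "finite \<C>" "M \<subseteq> \<Union>\<C>"
      "card \<C> = cover_number mtopology (cover_join mtopology \<phi> \<A> (n + 2 * k))"
      using minimal_join_subcover[OF \<A>(1)] .
    let ?\<D> = "(\<lambda>C. (\<phi> ^^ k) ` C) ` \<C>"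
    have "cover_number mtopology (cover_join mtopology \<phi> \<U> n) \<le> card ?\<D>"
    proof (rule cover_number_le_if_refines)
      show "finite ?\<D>" using \<C>(2) by simp
      have "(\<phi> ^^ k) ` M \<subseteq> \<Union>?\<D>" using \<C>(3) by blast
      then show "topspace mtopology \<subseteq> \<Union>?\<D>" unfolding funpow_image by simp
      show "refines ?\<D> (cover_join mtopology \<phi> \<U> n)"
        unfolding refines_def
      proof
        fix D assume "D \<in> ?\<D>"
        then obtain C where C: "C \<in> \<C>" "D = (\<phi> ^^ k) ` C" by blast
        have C': "C \<in> cover_join mtopology \<phi> \<A> (n + 2 * k)" using C(1) \<C>(1) by blast
        then have CM: "C \<subseteq> M" unfolding cover_join_def by auto
        obtain x0 where x0: "x0 \<in> M" "C \<noteq> {} \<Longrightarrow> x0 \<in> C" using CM nonempty by blast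
        have "\<exists>U. U \<in> \<U> \<and> mball ((\<phi> ^^ (k + j)) x0) \<rho> \<subseteq> U" for j
          using \<rho>(2)[OF funpow_in_M[OF x0(1)]] by blast
        then obtain W where W: "\<And>j. W j \<in> \<U>" "\<And>j. mball ((\<phi> ^^ (k + j)) x0) \<rho> \<subseteq> W j" by metis
        let ?E = "{x \<in> topspace mtopology. \<forall>j<n. (\<phi> ^^ j) x \<in> W j}"
        have "D \<subseteq> ?E"
        proof
          fix y assume "y \<in> D"
          then obtain x where x: "x \<in> C" "y = (\<phi> ^^ k) x" using C(2) by blast
          have "(\<phi> ^^ j) y \<in> W j" if "j < n" for j
          proof -
            have "d ((\<phi> ^^ (k + j)) x0) ((\<phi> ^^ (k + j)) x) \<le> 2 * eps * inverse lam ^ k"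
              using \<open>j < n\<close> x(1) x0(2) by (intro join_tracking[OF \<delta> \<A>(2) C']) auto
            then have "(\<phi> ^^ (k + j)) x \<in> mball ((\<phi> ^^ (k + j)) x0) \<rho>"
              using k x0(1) x(1) CM funpow_in_M by auto
            moreover have "(\<phi> ^^ j) y = (\<phi> ^^ (k + j)) x"
              unfolding x(2) by (subst add.commute) (simp add: funpow_add)
            ultimately show ?thesis using W(2)[of j] by (metis subsetD)
          qed
          then show "y \<in> ?E" using x CM funpow_in_M by auto
        qed
        moreover have "?E \<in> cover_join mtopology \<phi> \<U> n" using W(1) unfolding cover_join_def by blast
        ultimately show "\<exists>U\<in>cover_join mtopology \<phi> \<U> n. D \<subseteq> U" by blast
      qed
    qed
    also have "\<dots> \<le> card \<C>" by (rule card_image_le[OF \<C>(2)])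
    finally show "cover_number mtopology (cover_join mtopology \<phi> \<U> n) \<le>
      cover_number mtopology (cover_join mtopology \<phi> \<A> (n + 2 * k))" using \<C>(4) by simp
  qed
qed

lemma cover_number_join_pos:
  "open_cover mtopology \<U> \<Longrightarrow> 0 < cover_number mtopology (cover_join mtopology \<phi> \<U> n)"
  using cover_number_pos[OF compact open_cover_cover_join[OF phi_continuous]] nonempty by simp

text \<open>
  A generator \<open>\<A>\<close> bounds the entropy of every cover by \<open>ln (card \<A>)\<close>, because the shift \<open>2 * k\<close> in
  the length of the join disappears in the limit.
\<close>

lemma topological_entropy_real:
  obtains h where "topological_entropy mtopology \<phi> = ereal h"
proof -
  obtain \<delta> where \<delta>0: "0 < \<delta>" and \<delta>: "tracking_scale \<delta>"
    using exponential_tracking .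
  obtain \<A> where \<A>: "open_cover mtopology \<A>" "finite \<A>"
    "mesh_le \<A> \<delta>"
    using finite_small_cover[OF compact \<delta>0] .
  have "\<A> \<noteq> {}" using \<A>(1) nonempty unfolding open_cover_def by auto
  then have card\<A>: "card \<A> > 0" using \<A>(2) by (simp add: card_gt_0_iff)
  have upper: "cover_entropy mtopology \<phi> \<U> \<le> ereal (ln (real (card \<A>)))" if \<U>: "open_cover mtopology \<U>" for \<U>
  proof -
    let ?N = "\<lambda>n. cover_number mtopology (cover_join mtopology \<phi> \<U> n)"
    obtain k where k: "\<forall>n. ?N n \<le> cover_number mtopology (cover_join mtopology \<phi> \<A> (n + 2 * k))"
      using cover_number_join_le_generator[OF \<delta> \<A>(1,3) \<U>] .
    let ?b = "\<lambda>n. real (n + 2 * k) * ln (real (card \<A>)) / real n"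
    have "ln (real (?N n)) / real n \<le> ?b n" for n
    proof -
      have "?N n \<le> card \<A> ^ (n + 2 * k)"
        using k[rule_format, of n] cover_number_cover_join_le[OF phi_continuous \<A>(1,2), of "n + 2 * k"] by linarith
      then have "real (?N n) \<le> real (card \<A>) ^ (n + 2 * k)" by (metis of_nat_le_iff of_nat_power)
      then have "ln (real (?N n)) \<le> ln (real (card \<A>) ^ (n + 2 * k))"
        using cover_number_join_pos[OF \<U>, of n] card\<A> by (subst ln_le_cancel_iff) auto
      then show ?thesis using card\<A> by (intro divide_right_mono) (auto simp: ln_realpow)
    qed
    then have "cover_entropy mtopology \<phi> \<U> \<le> limsup (\<lambda>n. ereal (?b n))"
      unfolding cover_entropy_def by (intro Limsup_mono) auto
    also have "?b \<longlonglongrightarrow> ln (real (card \<A>))"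
    proof -
      have "(\<lambda>n. (1 + real (2 * k) * inverse (real n)) * ln (real (card \<A>))) \<longlonglongrightarrow>
          (1 + real (2 * k) * 0) * ln (real (card \<A>))"
        by (intro tendsto_intros LIMSEQ_inverse_real_of_nat lim_inverse_n)
      moreover have "\<forall>\<^sub>F n in sequentially.
          (1 + real (2 * k) * inverse (real n)) * ln (real (card \<A>)) = ?b n"
        using eventually_gt_at_top[of 0] by eventually_elim (simp add: field_simps)
      ultimately show ?thesis by (simp add: tendsto_cong)
    qed
    then have "limsup (\<lambda>n. ereal (?b n)) = ereal (ln (real (card \<A>)))"
      by (intro lim_imp_Limsup) auto
    finally show ?thesis .
  qed
  have "topological_entropy mtopology \<phi> \<le> ereal (ln (real (card \<A>)))"
    unfolding topological_entropy_def using upper by (intro SUP_least) auto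
  moreover have "0 \<le> topological_entropy mtopology \<phi>"
  proof -
    have "0 = limsup (\<lambda>n::nat. 0::ereal)" by (simp add: Limsup_const)
    also have "\<dots> \<le> cover_entropy mtopology \<phi> \<A>"
      unfolding cover_entropy_def
      using cover_number_join_pos[OF \<A>(1)] 
      by (intro Limsup_mono always_eventually allI) (simp add: Suc_le_eq ln_ge_zero)
    also have "\<dots> \<le> topological_entropy mtopology \<phi>"
      unfolding topological_entropy_def using \<A>(1) by (intro SUP_upper) auto
    finally show ?thesis .
  qed
  ultimately show thesis using that by (cases "topological_entropy mtopology \<phi>") auto
qed

text \<open>
  At scale \<open>r = 2 * eps * lam\<^sup>-\<^sup>k\<close> about \<open>exp (2 * k * s)\<close> sets suffice for any \<open>s > h\<close>, so the number of
  sets times \<open>r ^ Suc n\<close> decays like \<open>exp (2 * s - Suc n * ln lam) ^ k\<close>.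
\<close>

lemma covering_dim_le_if_entropy_small:
  assumes h: "topological_entropy mtopology \<phi> = ereal h" and small: "2 * h < real (Suc n) * ln lam"
  shows "covering_dim_le mtopology n"
proof (rule covering_dim_le_if_few_small_sets[OF compact])
  fix c :: real assume c: "0 < c"
  obtain \<delta> where \<delta>0: "0 < \<delta>" and \<delta>: "tracking_scale \<delta>"
    using exponential_tracking .
  obtain \<A> where \<A>: "open_cover mtopology \<A>" "finite \<A>"
    "mesh_le \<A> \<delta>"
    using finite_small_cover[OF compact \<delta>0] .
  let ?N = "\<lambda>n. cover_number mtopology (cover_join mtopology \<phi> \<A> n)"
  let ?r = "\<lambda>k. 2 * eps * inverse lam ^ k"
  \<comment> \<open>The midpoint between \<open>h\<close> and the critical value \<open>Suc n * ln lam / 2\<close>.\<close>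
  define s where "s = (h + real (Suc n) * ln lam / 2) / 2"
  have s: "h < s" "2 * s < real (Suc n) * ln lam" using small by (auto simp: s_def field_simps)
  have "cover_entropy mtopology \<phi> \<A> \<le> ereal h"
    unfolding h[symmetric] topological_entropy_def using \<A>(1) by (intro SUP_upper) auto
  also have "\<dots> < ereal s" using s by simp
  finally have "\<forall>\<^sub>F m in sequentially. ereal (ln (real (?N m)) / real m) < ereal s"
    unfolding cover_entropy_def by (rule Limsup_lessD)
  then have ev: "\<forall>\<^sub>F m in sequentially. real (?N m) < exp (real m * s)"
    using eventually_gt_at_top[of 0]
  proof eventually_elim
    case (elim m)
    then have "ln (real (?N m)) < real m * s" by (simp add: pos_divide_less_eq mult.commute)
    then have "exp (ln (real (?N m))) < exp (real m * s)" by simp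
    then show ?case using cover_number_join_pos[OF \<A>(1), of m] by simp
  qed
  have sub: "filterlim (\<lambda>k. 2 * k + 1 :: nat) sequentially sequentially"
    by (rule filterlim_subseq) (auto simp: strict_mono_def)
  define q where "q = exp (2 * s - real (Suc n) * ln lam)"
  have q: "0 < q" "q < 1" using s by (auto simp: q_def)
  have lim: "(\<lambda>k. exp s * (2 * eps) ^ Suc n * q ^ k) \<longlonglongrightarrow> exp s * (2 * eps) ^ Suc n * 0"
    using q by (intro tendsto_intros LIMSEQ_realpow_zero) auto
  have limr: "?r \<longlonglongrightarrow> 2 * eps * 0"
    using lam_gt_1 by (intro tendsto_intros LIMSEQ_realpow_zero) (auto simp: inverse_less_1_iff)
  have "\<forall>\<^sub>F k in sequentially. exp s * (2 * eps) ^ Suc n * q ^ k < c"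
    using order_tendstoD(2)[OF lim, of c] c by simp
  moreover have "\<forall>\<^sub>F k in sequentially. ?r k < c"
    using order_tendstoD(2)[OF limr, of c] c by simp
  moreover have "\<forall>\<^sub>F k in sequentially. real (?N (2 * k + 1)) < exp (real (2 * k + 1) * s)"
    using filterlim_iff[THEN iffD1, OF sub, rule_format, OF ev] .
  ultimately have "\<forall>\<^sub>F k in sequentially. exp s * (2 * eps) ^ Suc n * q ^ k < c \<and> ?r k < c \<and>
      real (?N (2 * k + 1)) < exp (real (2 * k + 1) * s)" by eventually_elim auto
  then obtain k where k: "exp s * (2 * eps) ^ Suc n * q ^ k < c" "?r k < c"
      "real (?N (2 * k + 1)) < exp (real (2 * k + 1) * s)"
    by (metis (no_types, lifting) eventually_happens trivial_limit_sequentially)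
  obtain \<C> where \<C>: "\<C> \<subseteq> cover_join mtopology \<phi> \<A> (2 * k + 1)" "finite \<C>" "M \<subseteq> \<Union>\<C>"
    "card \<C> = ?N (2 * k + 1)"
    using minimal_join_subcover[OF \<A>(1)] .
  let ?\<D> = "(\<lambda>C. (\<phi> ^^ k) ` C) ` \<C>"
  show "\<exists>r \<C>. 0 < r \<and> r \<le> c \<and> finite \<C> \<and> \<Union>\<C> = M \<and>
       mesh_le \<C> r \<and> real (card \<C>) * r ^ Suc n < c"
  proof (intro exI conjI)
    show "0 < ?r k" using eps_pos lam_gt_1 by simp
    show "?r k \<le> c" using k(2) by simp
    show "finite ?\<D>" using \<C>(2) by simp
    have "(\<phi> ^^ k) ` M \<subseteq> \<Union>?\<D>" using \<C>(3) by blast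
    then have "M \<subseteq> \<Union>?\<D>" unfolding funpow_image .
    moreover have "\<Union>?\<D> \<subseteq> M" using \<C>(1) funpow_in_M unfolding cover_join_def by auto
    ultimately show "\<Union>?\<D> = M" by blast
    show "mesh_le ?\<D> (?r k)"
      unfolding mesh_le_def
    proof (intro ballI)
      fix D x y assume "D \<in> ?\<D>" "x \<in> D" "y \<in> D"
      then obtain C x' y' where C: "C \<in> \<C>" "x' \<in> C" "y' \<in> C" "x = (\<phi> ^^ k) x'" "y = (\<phi> ^^ k) y'" by blast
      have C': "C \<in> cover_join mtopology \<phi> \<A> (2 * k + 1)" using C(1) \<C>(1) by blast
      have "d ((\<phi> ^^ (k + 0)) x') ((\<phi> ^^ (k + 0)) y') \<le> ?r k"
        by (rule join_tracking[OF \<delta> \<A>(3) C' C(2,3)]) auto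
      then show "d x y \<le> ?r k" using C by simp
    qed
    have "real (card ?\<D>) \<le> real (?N (2 * k + 1))" using card_image_le[OF \<C>(2)] \<C>(4) by simp
    then have "real (card ?\<D>) * ?r k ^ Suc n \<le> exp (real (2 * k + 1) * s) * ?r k ^ Suc n"
      using k(3) eps_pos lam_gt_1 by (intro mult_right_mono) auto
    also have "\<dots> = exp s * (2 * eps) ^ Suc n * q ^ k"
    proof -
      have "?r k ^ Suc n = (2 * eps) ^ Suc n * inverse lam ^ (Suc n * k)"
        by (simp only: power_mult_distrib power_mult[symmetric] mult.commute)
      also have "inverse lam ^ (Suc n * k) = exp (- (real (Suc n * k) * ln lam))"
        using lam_gt_1 by (simp only: exp_minus exp_of_nat_mult power_inverse exp_ln)
      finally have "exp (real (2 * k + 1) * s) * ?r k ^ Suc n =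
          (2 * eps) ^ Suc n * (exp (real (2 * k + 1) * s) * exp (- (real (Suc n * k) * ln lam)))"
        by (simp only: mult_ac)
      also have "exp (real (2 * k + 1) * s) * exp (- (real (Suc n * k) * ln lam)) = exp s * q ^ k"
        unfolding q_def exp_of_nat_mult[symmetric] exp_add[symmetric] by (simp add: algebra_simps)
      finally show ?thesis by (simp only: mult_ac)
    qed
    finally show "real (card ?\<D>) * ?r k ^ Suc n < c" using k(1) by linarith
  qed
qed

lemma covering_dim_lam_le_entropy:
  assumes h: "topological_entropy mtopology \<phi> = ereal h" and pos: "covering_dim mtopology > 0"
  obtains n where "covering_dim mtopology = enat n" "0 < n" "real n * ln lam \<le> 2 * h"
proof -
  have dim_le: "covering_dim mtopology \<le> enat n" if "2 * h < real (Suc n) * ln lam" for n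
    using covering_dim_le_if_entropy_small[OF h that] unfolding covering_dim_def by (intro Inf_lower) auto
  have "ln lam > 0" using lam_gt_1 by simp
  then obtain m where "2 * h < real m * ln lam" using reals_Archimedean3 by blast
  also have "\<dots> \<le> real (Suc m) * ln lam" using \<open>ln lam > 0\<close> by simp
  finally have "covering_dim mtopology \<le> enat m" by (rule dim_le)
  then obtain n where n: "covering_dim mtopology = enat n" by (cases "covering_dim mtopology") auto
  then obtain n' where n': "n = Suc n'" using pos by (cases n) (auto simp: zero_enat_def)
  show thesis
  proof (rule that[OF n])
    show "real n * ln lam \<le> 2 * h" using dim_le[of n'] n n' by force
  qed (simp add: n')
qed

end

section \<open>Itinerary metrics in dimension zero\<close>

text \<open>
  The value \<open>\<mu>\<^sup>n\<close> at the first index \<open>n\<close> at which \<open>P\<close> fails: the usual distance on sequence spaces, where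
  \<open>P N\<close> is agreement up to \<open>N\<close>.  The lemmas below turn implications between agreement predicates, possibly
  shifted by one index, into the metric inequalities.
\<close>

definition first_failure_weight :: "real \<Rightarrow> (nat \<Rightarrow> bool) \<Rightarrow> real" where
  "first_failure_weight \<mu> P = (if \<forall>N. P N then 0 else \<mu> ^ (LEAST N. \<not> P N))"

context
  fixes \<mu> :: real
  assumes \<mu>: "0 < \<mu>" "\<mu> < 1"
begin

lemma first_failure_weight_nonneg: "0 \<le> first_failure_weight \<mu> P"
  using \<mu> by (simp add: first_failure_weight_def)

lemma first_failure_weight_eq_0_iff: "first_failure_weight \<mu> P = 0 \<longleftrightarrow> (\<forall>N. P N)"
  using \<mu> by (simp add: first_failure_weight_def)

lemma first_failure_weight_ge: "\<not> P N \<Longrightarrow> \<mu> ^ N \<le> first_failure_weight \<mu> P"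
  using \<mu> Least_le[of "\<lambda>N. \<not> P N" N] by (auto simp: first_failure_weight_def intro!: power_decreasing)

lemma first_failure_weight_cases:
  obtains "first_failure_weight \<mu> P = 0"
  | N where "\<not> P N" "first_failure_weight \<mu> P = \<mu> ^ N"
proof (cases "\<forall>N. P N")
  case False
  then have "\<not> P (LEAST N. \<not> P N)" using LeastI_ex[of "\<lambda>N. \<not> P N"] by blast
  moreover have "first_failure_weight \<mu> P = \<mu> ^ (LEAST N. \<not> P N)"
    unfolding first_failure_weight_def using False by (simp only: if_False)
  ultimately show thesis by (rule that(2))
qed (use that in \<open>simp add: first_failure_weight_def\<close>)

lemma first_failure_weight_less:
  assumes "P N" "\<And>m n. \<lbrakk>m \<le> n; P n\<rbrakk> \<Longrightarrow> P m"
  shows "first_failure_weight \<mu> P < \<mu> ^ N"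
proof (cases rule: first_failure_weight_cases[of P])
  case (2 m)
  then have "N < m" using assms by (meson not_less)
  then show ?thesis using 2 \<mu> by (simp add: power_strict_decreasing)
qed (use \<mu> in simp)

lemma first_failure_weight_triangle:
  assumes "\<And>N. \<lbrakk>P N; Q N\<rbrakk> \<Longrightarrow> R N"
  shows "first_failure_weight \<mu> R \<le> first_failure_weight \<mu> P + first_failure_weight \<mu> Q"
proof (cases rule: first_failure_weight_cases[of R])
  case 1
  then show ?thesis using first_failure_weight_nonneg[of P] first_failure_weight_nonneg[of Q] by simp
next
  case (2 N)
  then have "\<not> P N \<or> \<not> Q N" using assms by blast
  then show ?thesis
    using 2(2) first_failure_weight_ge[of P N] first_failure_weight_ge[of Q N]
      first_failure_weight_nonneg[of P] first_failure_weight_nonneg[of Q] by fastforce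
qed

lemma first_failure_weight_contract:
  assumes "Q 0" "\<And>N. P N \<Longrightarrow> Q (Suc N)"
  shows "first_failure_weight \<mu> Q \<le> \<mu> * first_failure_weight \<mu> P"
proof (cases rule: first_failure_weight_cases[of Q])
  case 1
  then show ?thesis using first_failure_weight_nonneg[of P] \<mu> by simp
next
  case (2 N)
  then obtain m where "N = Suc m" using assms(1) by (cases N) auto
  then show ?thesis using 2 \<mu> first_failure_weight_ge[of P m] assms(2)[of m] by auto
qed

lemma first_failure_weight_expand:
  assumes "\<And>N. P (Suc N) \<Longrightarrow> Q N"
  shows "first_failure_weight \<mu> Q \<le> inverse \<mu> * first_failure_weight \<mu> P"
proof (cases rule: first_failure_weight_cases[of Q])
  case 1
  then show ?thesis using first_failure_weight_nonneg[of P] \<mu> by simp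
next
  case (2 N)
  then have "\<mu> * \<mu> ^ N \<le> first_failure_weight \<mu> P" using first_failure_weight_ge[of P "Suc N"] assms by auto
  then have "inverse \<mu> * (\<mu> * \<mu> ^ N) \<le> inverse \<mu> * first_failure_weight \<mu> P"
    using \<mu> by (intro mult_left_mono) auto
  then show ?thesis using 2(2) \<mu> by (simp add: field_simps)
qed

end

context smale_space
begin

abbreviation \<psi> :: "'a \<Rightarrow> 'a" where "\<psi> \<equiv> inv_into M \<phi>"

lemma psi_continuous: "continuous_map mtopology mtopology \<psi>"
proof -
  obtain g where g: "homeomorphic_maps mtopology mtopology \<phi> g"
    using homeo homeomorphic_map_maps by blast
  have "continuous_map mtopology mtopology g" using g by (simp add: homeomorphic_maps_def)
  then show ?thesis
  proof (rule continuous_map_eq)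
    fix y assume "y \<in> topspace mtopology"
    then have "y \<in> M" by simp
    then obtain x where x: "x \<in> M" "y = \<phi> x" using phi_image by blast
    then show "g y = \<psi> y" using g phi_inj by (simp add: homeomorphic_maps_def)
  qed
qed

lemma psi_in_M: "x \<in> M \<Longrightarrow> \<psi> x \<in> M"
  by (simp add: inv_into_into phi_image)

lemma phi_psi: "x \<in> M \<Longrightarrow> \<phi> (\<psi> x) = x"
  by (simp add: f_inv_into_f phi_image)

lemma psi_phi: "x \<in> M \<Longrightarrow> \<psi> (\<phi> x) = x"
  using phi_inj by simp

lemma phi_in_M: "x \<in> M \<Longrightarrow> \<phi> x \<in> M"
  using phi_image by blast

lemma funpow_psi_in_M: "x \<in> M \<Longrightarrow> (\<psi> ^^ n) x \<in> M"
  by (induction n) (auto simp: psi_in_M)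

lemma funpow_phi_psi: "x \<in> M \<Longrightarrow> (\<phi> ^^ i) ((\<psi> ^^ (i + j)) x) = (\<psi> ^^ j) x"
proof (induction i)
  case (Suc i)
  have "(\<phi> ^^ Suc i) ((\<psi> ^^ (Suc i + j)) x) = (\<phi> ^^ i) (\<phi> (\<psi> ((\<psi> ^^ (i + j)) x)))"
    by (simp add: funpow_swap1)
  then show ?case using Suc by (simp add: phi_psi funpow_psi_in_M)
qed simp

text \<open>
  Local stable sets are mapped into local stable sets of the same radius, because contraction keeps the image
  pair in the domain where the bracket is equivariant.
\<close>

lemma stable_step:
  assumes "x \<in> M" "0 < e" "e \<le> eps" "y \<in> local_stable M d br x e"
  shows "\<phi> y \<in> local_stable M d br (\<phi> x) e"
proof -
  have y: "y \<in> M" "d x y < e" "br x y = y" using assms(4) by (auto simp: local_stable_def)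
  have "d (\<phi> x) (\<phi> y) \<le> inverse lam * d x y"
    using assms bracket_same by (intro stable_contraction) (auto simp: local_stable_def)
  also have "\<dots> \<le> d x y" using lam_gt_1 by (intro mult_left_le_one_le) (auto simp: inverse_le_1_iff)
  finally have "d (\<phi> x) (\<phi> y) < e" using y by simp
  moreover from this have "br (\<phi> x) (\<phi> y) = \<phi> y"
    using bracket_equivariant[of x y] y assms by simp
  ultimately show ?thesis using y phi_in_M by (auto simp: local_stable_def)
qed

text \<open>
  Equivariance is given for \<open>\<phi>\<close> only, so it is applied to the preimages, and injectivity of \<open>\<phi>\<close> then
  identifies the bracket.
\<close>

lemma unstable_step:
  assumes "x \<in> M" "0 < e" "e \<le> eps" "y \<in> local_unstable M d br x e"
  shows "\<psi> y \<in> local_unstable M d br (\<psi> x) e"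
proof -
  have y: "y \<in> M" "d x y < e" "br y x = y" using assms(4) by (auto simp: local_unstable_def)
  have "d (\<psi> x) (\<psi> y) \<le> inverse lam * d x y"
    using assms bracket_same by (intro unstable_contraction) (auto simp: local_unstable_def)
  also have "\<dots> \<le> d x y" using lam_gt_1 by (intro mult_left_le_one_le) (auto simp: inverse_le_1_iff)
  finally have le: "d (\<psi> x) (\<psi> y) < e" using y by simp
  have M: "\<psi> x \<in> M" "\<psi> y \<in> M" using assms y psi_in_M by auto
  have "\<phi> (br (\<psi> y) (\<psi> x)) = br y x"
    using bracket_equivariant[of "\<psi> y" "\<psi> x"] y assms le M commute[of y x] commute[of "\<psi> y" "\<psi> x"]
    by (simp add: phi_psi)
  moreover have "br (\<psi> y) (\<psi> x) \<in> M"
    using bracket_in_M[of "\<psi> y" "\<psi> x"] M le assms commute[of "\<psi> y" "\<psi> x"] by simp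
  ultimately have "br (\<psi> y) (\<psi> x) = \<psi> y" using y by (metis psi_phi)
  then show ?thesis using le M by (auto simp: local_unstable_def)
qed

lemma stable_iterate:
  assumes "x \<in> M" "0 < e" "e \<le> eps" "y \<in> local_stable M d br x e"
  shows "(\<phi> ^^ i) y \<in> local_stable M d br ((\<phi> ^^ i) x) e"
  using assms by (induction i) (auto intro: stable_step funpow_in_M)

lemma unstable_iterate:
  assumes "x \<in> M" "0 < e" "e \<le> eps" "y \<in> local_unstable M d br x e"
  shows "(\<psi> ^^ i) y \<in> local_unstable M d br ((\<psi> ^^ i) x) e"
  using assms by (induction i) (auto intro: unstable_step funpow_psi_in_M)

end

text \<open>
  A Smale space with a partition into clopen sets so fine that itineraries separate points exponentially fast.
\<close>

locale partitioned_smale_space = smale_space +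
  fixes \<V> :: "'a set set" and \<delta> :: real
  assumes cover: "open_cover mtopology \<V>"
    and disjoint: "\<And>U V x. \<lbrakk>U \<in> \<V>; V \<in> \<V>; x \<in> U; x \<in> V\<rbrakk> \<Longrightarrow> U = V"
    and tracking: "tracking_scale \<delta>"
    and mesh: "mesh_le \<V> \<delta>"
begin

definition same_cell :: "'a \<Rightarrow> 'a \<Rightarrow> bool" where
  "same_cell x y \<longleftrightarrow> (\<forall>V\<in>\<V>. x \<in> V \<longleftrightarrow> y \<in> V)"

definition same_itinerary :: "nat \<Rightarrow> 'a \<Rightarrow> 'a \<Rightarrow> bool" where
  "same_itinerary N x y \<longleftrightarrow>
     (\<forall>i<N. same_cell ((\<phi> ^^ i) x) ((\<phi> ^^ i) y) \<and> same_cell ((\<psi> ^^ i) x) ((\<psi> ^^ i) y))"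

definition itinerary_dist :: "real \<Rightarrow> 'a \<Rightarrow> 'a \<Rightarrow> real" where
  "itinerary_dist \<mu> x y = first_failure_weight \<mu> (\<lambda>N. same_itinerary N x y)"

lemma same_cell_refl: "same_cell x x"
  and same_cell_sym: "same_cell x y \<Longrightarrow> same_cell y x"
  and same_cell_trans: "\<lbrakk>same_cell x y; same_cell y z\<rbrakk> \<Longrightarrow> same_cell x z"
  by (auto simp: same_cell_def)

lemma same_cellI: "\<lbrakk>V \<in> \<V>; x \<in> V; y \<in> V\<rbrakk> \<Longrightarrow> same_cell x y"
  using disjoint unfolding same_cell_def by blast

lemma cell_cases: "x \<in> M \<Longrightarrow> \<exists>V\<in>\<V>. x \<in> V"
  using cover unfolding open_cover_def by auto

lemma same_cell_close: "\<lbrakk>x \<in> M; same_cell x y\<rbrakk> \<Longrightarrow> d x y \<le> \<delta>"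
  using cell_cases[of x] mesh unfolding same_cell_def mesh_le_def by metis

lemma same_itinerary_antimono: "\<lbrakk>m \<le> n; same_itinerary n x y\<rbrakk> \<Longrightarrow> same_itinerary m x y"
  by (auto simp: same_itinerary_def)

lemma same_itinerary_commute: "same_itinerary N x y \<longleftrightarrow> same_itinerary N y x"
  unfolding same_itinerary_def using same_cell_sym by blast

lemma same_itinerary_trans: "\<lbrakk>same_itinerary N x y; same_itinerary N y z\<rbrakk> \<Longrightarrow> same_itinerary N x z"
  unfolding same_itinerary_def using same_cell_trans by blast

text \<open>
  Tracking starts from the \<open>n\<close>-th preimages; their first \<open>2 * n\<close> iterates run through the times \<open>-n\<close> to \<open>n\<close>.
\<close>

lemma same_itinerary_imp_close:
  assumes "x \<in> M" "y \<in> M" and same: "same_itinerary (Suc n) x y"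
  shows "d x y \<le> 2 * eps * inverse lam ^ n"
proof -
  have "d ((\<phi> ^^ n) ((\<psi> ^^ n) x)) ((\<phi> ^^ n) ((\<psi> ^^ n) y)) \<le> 2 * eps * inverse lam ^ n"
  proof (rule tracking_scaleD[OF tracking])
    show M: "(\<psi> ^^ n) x \<in> M" "(\<psi> ^^ n) y \<in> M" using assms funpow_psi_in_M by auto
    fix i assume i: "i \<le> 2 * n"
    have "same_cell ((\<phi> ^^ i) ((\<psi> ^^ n) x)) ((\<phi> ^^ i) ((\<psi> ^^ n) y))"
    proof (cases "i \<le> n")
      case True
      then have "(\<phi> ^^ i) ((\<psi> ^^ n) z) = (\<psi> ^^ (n - i)) z" if "z \<in> M" for z
        using funpow_phi_psi[OF that, of i "n - i"] by simp
      then show ?thesis using assms unfolding same_itinerary_def by simp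
    next
      case False
      have "(\<phi> ^^ i) ((\<psi> ^^ n) z) = (\<phi> ^^ (i - n)) z" if "z \<in> M" for z
      proof -
        have "(\<phi> ^^ i) ((\<psi> ^^ n) z) = (\<phi> ^^ (i - n)) ((\<phi> ^^ n) ((\<psi> ^^ n) z))"
          using False by (metis comp_apply funpow_add le_add_diff_inverse2 nat_le_linear)
        then show ?thesis using funpow_phi_psi[OF that, of n 0] by simp
      qed
      then show ?thesis using assms i False unfolding same_itinerary_def by simp
    qed
    then show "d ((\<phi> ^^ i) ((\<psi> ^^ n) x)) ((\<phi> ^^ i) ((\<psi> ^^ n) y)) \<le> \<delta>"
      using M funpow_in_M same_cell_close by blast
  qed
  then show ?thesis using assms funpow_phi_psi[of _ n 0] by simp
qed

lemma openin_same_cell: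
  assumes "a \<in> M"
  shows "openin mtopology {y \<in> M. same_cell a y}"
proof -
  obtain V where V: "V \<in> \<V>" "a \<in> V" using cell_cases[OF assms] by blast
  then have "openin mtopology V" using cover by (simp add: open_cover_def)
  moreover have "{y \<in> M. same_cell a y} = V"
  proof
    show "{y \<in> M. same_cell a y} \<subseteq> V"
    proof
      fix y assume "y \<in> {y \<in> M. same_cell a y}"
      then have "a \<in> V \<longleftrightarrow> y \<in> V" using V(1) unfolding same_cell_def by simp
      then show "y \<in> V" using V(2) by simp
    qed
    show "V \<subseteq> {y \<in> M. same_cell a y}"
      using openin_subset[OF calculation] same_cellI[OF V] by fastforce
  qed
  ultimately show ?thesis by simp
qed

lemma openin_same_itinerary:
  assumes "x \<in> M"
  shows "openin mtopology {y \<in> M. same_itinerary N x y}"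
proof (induction N)
  case 0
  then show ?case by (simp add: same_itinerary_def)
next
  case (Suc N)
  have pre: "openin mtopology {y \<in> M. same_cell ((f ^^ N) x) ((f ^^ N) y)}"
    if f: "continuous_map mtopology mtopology f" and fM: "(f ^^ N) x \<in> M" for f
  proof -
    have "openin mtopology {y \<in> topspace mtopology. (f ^^ N) y \<in> {z \<in> M. same_cell ((f ^^ N) x) z}}"
      by (rule openin_continuous_map_preimage[OF continuous_map_funpow[OF f] openin_same_cell[OF fM]])
    moreover have "(f ^^ N) y \<in> M" if "y \<in> M" for y
      using funcset_mem[OF continuous_map_funspace[OF continuous_map_funpow[OF f, of N]]] that by simp
    then have "{y \<in> topspace mtopology. (f ^^ N) y \<in> {z \<in> M. same_cell ((f ^^ N) x) z}} =
        {y \<in> M. same_cell ((f ^^ N) x) ((f ^^ N) y)}" by auto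
    ultimately show ?thesis by simp
  qed
  have "{y \<in> M. same_itinerary (Suc N) x y} = {y \<in> M. same_itinerary N x y} \<inter>
      ({y \<in> M. same_cell ((\<phi> ^^ N) x) ((\<phi> ^^ N) y)} \<inter> {y \<in> M. same_cell ((\<psi> ^^ N) x) ((\<psi> ^^ N) y)})"
    by (auto simp: same_itinerary_def less_Suc_eq)
  moreover have "openin mtopology \<dots>"
    using Suc pre[OF phi_continuous funpow_in_M[OF assms]] pre[OF psi_continuous funpow_psi_in_M[OF assms]]
    by (intro openin_Int)
  ultimately show ?case by simp
qed

text \<open>
  Passing from \<open>x\<close> to \<open>\<phi> x\<close> shifts the itinerary by one: the backward orbit of \<open>\<phi> x\<close> visits
  \<open>\<phi> x\<close>, which the hypothesis on forward orbits covers, and then the backward orbit of \<open>x\<close>.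
\<close>

lemma same_itinerary_phiI:
  assumes "x \<in> M" "y \<in> M" and fwd: "\<And>i. i \<le> N \<Longrightarrow> same_cell ((\<phi> ^^ i) x) ((\<phi> ^^ i) y)"
    and bwd: "\<And>i. Suc i < N \<Longrightarrow> same_cell ((\<psi> ^^ i) x) ((\<psi> ^^ i) y)"
  shows "same_itinerary N (\<phi> x) (\<phi> y)"
  unfolding same_itinerary_def
proof (intro allI impI conjI)
  fix i assume i: "i < N"
  show "same_cell ((\<phi> ^^ i) (\<phi> x)) ((\<phi> ^^ i) (\<phi> y))"
    using fwd[of "Suc i"] i by (simp add: funpow_swap1)
  show "same_cell ((\<psi> ^^ i) (\<phi> x)) ((\<psi> ^^ i) (\<phi> y))"
  proof (cases i)
    case 0
    then show ?thesis using fwd[of "Suc 0"] i by simp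
  next
    case (Suc j)
    have "(\<psi> ^^ i) (\<phi> z) = (\<psi> ^^ j) z" if "z \<in> M" for z
      unfolding Suc funpow_Suc_right using psi_phi[OF that] by simp
    then show ?thesis using bwd[of j] i Suc assms(1,2) by simp
  qed
qed

lemma same_itinerary_psiI:
  assumes "x \<in> M" "y \<in> M" and bwd: "\<And>i. i \<le> N \<Longrightarrow> same_cell ((\<psi> ^^ i) x) ((\<psi> ^^ i) y)"
    and fwd: "\<And>i. Suc i < N \<Longrightarrow> same_cell ((\<phi> ^^ i) x) ((\<phi> ^^ i) y)"
  shows "same_itinerary N (\<psi> x) (\<psi> y)"
  unfolding same_itinerary_def
proof (intro allI impI conjI)
  fix i assume i: "i < N"
  show "same_cell ((\<psi> ^^ i) (\<psi> x)) ((\<psi> ^^ i) (\<psi> y))"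
    using bwd[of "Suc i"] i by (simp add: funpow_swap1)
  show "same_cell ((\<phi> ^^ i) (\<psi> x)) ((\<phi> ^^ i) (\<psi> y))"
  proof (cases i)
    case 0
    then show ?thesis using bwd[of "Suc 0"] i by simp
  next
    case (Suc j)
    have "(\<phi> ^^ i) (\<psi> z) = (\<phi> ^^ j) z" if "z \<in> M" for z
      unfolding Suc funpow_Suc_right using phi_psi[OF that] by simp
    then show ?thesis using fwd[of j] i Suc assms(1,2) by simp
  qed
qed

context
  fixes \<mu> :: real
  assumes \<mu>: "0 < \<mu>" "\<mu> < 1"
begin

lemma itinerary_dist_less: "same_itinerary N x y \<Longrightarrow> itinerary_dist \<mu> x y < \<mu> ^ N"
  unfolding itinerary_dist_def
  by (rule first_failure_weight_less[OF \<mu>, where P="\<lambda>N. same_itinerary N x y"]) (auto intro: same_itinerary_antimono)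

lemma itinerary_dist_lessD: "itinerary_dist \<mu> x y < \<mu> ^ N \<Longrightarrow> same_itinerary N x y"
  unfolding itinerary_dist_def using first_failure_weight_ge[OF \<mu>, of "\<lambda>N. same_itinerary N x y" N] by force

lemma itinerary_metric: "Metric_space M (itinerary_dist \<mu>)"
proof
  fix x y
  show "0 \<le> itinerary_dist \<mu> x y"
    unfolding itinerary_dist_def by (rule first_failure_weight_nonneg[OF \<mu>])
  show "itinerary_dist \<mu> x y = itinerary_dist \<mu> y x"
    unfolding itinerary_dist_def by (subst same_itinerary_commute) (rule refl)
next
  fix x y assume xy: "x \<in> M" "y \<in> M"
  show "itinerary_dist \<mu> x y = 0 \<longleftrightarrow> x = y"
  proof
    assume "itinerary_dist \<mu> x y = 0"
    then have "same_itinerary N x y" for N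
      unfolding itinerary_dist_def first_failure_weight_eq_0_iff[OF \<mu>] by blast
    then have le: "d x y \<le> 2 * eps * inverse lam ^ n" for n using same_itinerary_imp_close[OF xy] by blast
    have "d x y \<le> 0"
    proof (rule ccontr)
      assume "\<not> d x y \<le> 0"
      then obtain n where "2 * eps * inverse lam ^ n < d x y"
        using inverse_power_small[of "d x y"] by auto
      then show False using le[of n] by simp
    qed
    then show "x = y" using xy nonneg[of x y] by simp
  next
    assume "x = y"
    then show "itinerary_dist \<mu> x y = 0"
      unfolding itinerary_dist_def first_failure_weight_eq_0_iff[OF \<mu>]
      by (simp add: same_itinerary_def same_cell_refl)
  qed
next
  fix x y z
  show "itinerary_dist \<mu> x z \<le> itinerary_dist \<mu> x y + itinerary_dist \<mu> y z"
    unfolding itinerary_dist_def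
    by (rule first_failure_weight_triangle[OF \<mu>]) (rule same_itinerary_trans)
qed

text \<open>
  Balls of the itinerary metric are determined by finitely many coordinates, hence open.  So its topology is a
  Hausdorff topology coarser than a compact one, and the two coincide.
\<close>

lemma itinerary_topology: "Metric_space.mtopology M (itinerary_dist \<mu>) = mtopology"
proof -
  interpret I: Metric_space M "itinerary_dist \<mu>" by (rule itinerary_metric)
  have "mtopology = I.mtopology"
  proof (rule compact_Hausdorff_space_optimal)
    fix U assume U: "openin I.mtopology U"
    show "openin mtopology U"
      unfolding openin_mtopology
    proof (intro conjI allI impI)
      show "U \<subseteq> M" using openin_subset[OF U] by simp
      fix x assume x: "x \<in> U"
      then have xM: "x \<in> M" using \<open>U \<subseteq> M\<close> by blast
      obtain r where r: "0 < r" "I.mball x r \<subseteq> U" using U x unfolding I.openin_mtopology by metis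
      obtain N where N: "\<mu> ^ N < r" using real_arch_pow_inv[OF r(1) \<mu>(2)] by blast
      have "x \<in> {y \<in> M. same_itinerary N x y}"
        using xM by (simp add: same_itinerary_def same_cell_refl)
      then obtain s where s: "0 < s" "mball x s \<subseteq> {y \<in> M. same_itinerary N x y}"
        using openin_same_itinerary[OF xM, of N] unfolding openin_mtopology by metis
      have "{y \<in> M. same_itinerary N x y} \<subseteq> I.mball x r"
        using itinerary_dist_less[of N x] N xM by force
      then show "\<exists>r>0. mball x r \<subseteq> U" using s r by (meson order_trans)
    qed
  qed (use compact I.Hausdorff_space_mtopology in auto)
  then show ?thesis by simp
qed

lemma itinerary_dist_phi:
  assumes "x \<in> M" "y \<in> M"
  shows "itinerary_dist \<mu> (\<phi> x) (\<phi> y) \<le> inverse \<mu> * itinerary_dist \<mu> x y"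
  unfolding itinerary_dist_def
  by (rule first_failure_weight_expand[OF \<mu>], rule same_itinerary_phiI[OF assms])
    (auto simp: same_itinerary_def)

lemma itinerary_dist_psi:
  assumes "x \<in> M" "y \<in> M"
  shows "itinerary_dist \<mu> (\<psi> x) (\<psi> y) \<le> inverse \<mu> * itinerary_dist \<mu> x y"
  unfolding itinerary_dist_def
  by (rule first_failure_weight_expand[OF \<mu>], rule same_itinerary_psiI[OF assms])
    (auto simp: same_itinerary_def)

text \<open>
  If forward itineraries agree, the first difference lies in the past, and \<open>\<phi>\<close> moves it one step further away.
\<close>

lemma itinerary_dist_phi_contract:
  assumes "x \<in> M" "y \<in> M" "\<And>i. same_cell ((\<phi> ^^ i) x) ((\<phi> ^^ i) y)"
  shows "itinerary_dist \<mu> (\<phi> x) (\<phi> y) \<le> \<mu> * itinerary_dist \<mu> x y"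
  unfolding itinerary_dist_def
proof (rule first_failure_weight_contract[OF \<mu>])
  show "same_itinerary 0 (\<phi> x) (\<phi> y)" by (simp add: same_itinerary_def)
  show "same_itinerary (Suc N) (\<phi> x) (\<phi> y)" if "same_itinerary N x y" for N
    using that assms(3) by (intro same_itinerary_phiI assms(1,2)) (auto simp: same_itinerary_def)
qed

lemma itinerary_dist_psi_contract:
  assumes "x \<in> M" "y \<in> M" "\<And>i. same_cell ((\<psi> ^^ i) x) ((\<psi> ^^ i) y)"
  shows "itinerary_dist \<mu> (\<psi> x) (\<psi> y) \<le> \<mu> * itinerary_dist \<mu> x y"
  unfolding itinerary_dist_def
proof (rule first_failure_weight_contract[OF \<mu>])
  show "same_itinerary 0 (\<psi> x) (\<psi> y)" by (simp add: same_itinerary_def)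
  show "same_itinerary (Suc N) (\<psi> x) (\<psi> y)" if "same_itinerary N x y" for N
    using that assms(3) by (intro same_itinerary_psiI assms(1,2)) (auto simp: same_itinerary_def)
qed

text \<open>
  The bracket is kept; the new constant \<open>e\<close> is so small that points at itinerary distance at most \<open>e\<close> are within
  \<open>e0\<close> in the old metric.  All identities of the bracket are then inherited.  On local stable sets of radius
  \<open>e0\<close> forward orbits stay closer than the Lebesgue number \<open>\<rho>\<close> of the partition, so forward itineraries agree
  and the contraction applies; unstable sets are treated in the same way with \<open>\<psi>\<close>.
\<close>

lemma itinerary_smale_space:
  "\<exists>e. self_similar_smale_space M (itinerary_dist \<mu>) \<phi> e (inverse \<mu>) br"
proof -
  interpret I: Metric_space M "itinerary_dist \<mu>" by (rule itinerary_metric)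
  obtain \<rho> where \<rho>: "0 < \<rho>" "\<And>x. x \<in> M \<Longrightarrow> \<exists>U\<in>\<V>. mball x \<rho> \<subseteq> U"
    using Lebesgue_number[OF compact cover] by blast
  have near_same: "same_cell x y" if "x \<in> M" "y \<in> M" "d x y < \<rho>" for x y
  proof -
    obtain V where V: "V \<in> \<V>" "mball x \<rho> \<subseteq> V" using \<rho>(2)[OF \<open>x \<in> M\<close>] by blast
    have "x \<in> mball x \<rho>" "y \<in> mball x \<rho>" using that \<rho>(1) by auto
    then show ?thesis using V same_cellI by blast
  qed
  define e0 where "e0 = min eps \<rho>"
  have e0: "0 < e0" "e0 \<le> eps" "e0 \<le> \<rho>" using eps_pos \<rho>(1) by (auto simp: e0_def)
  obtain n where n: "2 * eps * inverse lam ^ n < e0" using inverse_power_small[OF e0(1)] .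
  define e where "e = \<mu> ^ Suc (Suc n)"
  have e_pos: "0 < e" using \<mu> by (simp add: e_def)
  have e_less: "e < \<mu> ^ Suc n" unfolding e_def using \<mu> by (intro power_strict_decreasing) auto
  have close: "d x y < e0" if "x \<in> M" "y \<in> M" "itinerary_dist \<mu> x y \<le> e" for x y
  proof -
    have "same_itinerary (Suc n) x y" using that(3) e_less by (intro itinerary_dist_lessD) simp
    then show ?thesis using same_itinerary_imp_close[OF that(1,2)] n by (meson le_less_trans)
  qed
  have close': "d x y \<le> eps" if "x \<in> M" "y \<in> M" "itinerary_dist \<mu> x y \<le> e" for x y
    using close[OF that] e0 by simp
  have stable: "y \<in> local_stable M d br x e0"
    if "x \<in> M" "e' \<le> e" "y \<in> local_stable M (itinerary_dist \<mu>) br x e'" for x y e'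
    using that close[of x y] by (auto simp: local_stable_def)
  have unstable: "y \<in> local_unstable M d br x e0"
    if "x \<in> M" "e' \<le> e" "y \<in> local_unstable M (itinerary_dist \<mu>) br x e'" for x y e'
    using that close[of x y] by (auto simp: local_unstable_def)
  have stable_same: "same_cell ((\<phi> ^^ i) x) ((\<phi> ^^ i) y)" if "x \<in> M" "y \<in> local_stable M d br x e0" for x y i
    using stable_iterate[OF that(1) e0(1,2) that(2), of i] funpow_in_M[OF that(1)] e0(3)
    by (intro near_same) (auto simp: local_stable_def)
  have unstable_same: "same_cell ((\<psi> ^^ i) x) ((\<psi> ^^ i) y)" if "x \<in> M" "y \<in> local_unstable M d br x e0" for x y i
    using unstable_iterate[OF that(1) e0(1,2) that(2), of i] funpow_psi_in_M[OF that(1)] e0(3)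
    by (intro near_same) (auto simp: local_unstable_def)
  have "self_similar_smale_space M (itinerary_dist \<mu>) \<phi> e (inverse \<mu>) br"
  proof (intro self_similar_smale_space.intro smale_space.intro smale_space_axioms.intro
      self_similar_smale_space_axioms.intro itinerary_metric; (unfold itinerary_topology)?)
    show "infinite M" "compact_space mtopology" "homeomorphic_map mtopology mtopology \<phi>" "0 < e"
      using infinite_carrier compact homeo e_pos by auto
    show "1 < inverse \<mu>" using \<mu> by (simp add: one_less_inverse)
    show "continuous_map (subtopology (prod_topology mtopology mtopology)
        {(x, y). x \<in> M \<and> y \<in> M \<and> itinerary_dist \<mu> x y \<le> e}) mtopology (\<lambda>(x, y). br x y)"
      by (rule continuous_map_from_subtopology_mono[OF bracket_continuous]) (use close' in auto)
    show "br x x = x" if "x \<in> M" for x using that by (rule bracket_same)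
    show "br x (br y z) = br x z" if "x \<in> M" "y \<in> M" "z \<in> M" "itinerary_dist \<mu> y z \<le> e"
      "itinerary_dist \<mu> x (br y z) \<le> e" "itinerary_dist \<mu> x z \<le> e" for x y z
      using that close' bracket_in_M by (intro bracket_right) auto
    show "br (br x y) z = br x z" if "x \<in> M" "y \<in> M" "z \<in> M" "itinerary_dist \<mu> x y \<le> e"
      "itinerary_dist \<mu> (br x y) z \<le> e" "itinerary_dist \<mu> x z \<le> e" for x y z
      using that close' bracket_in_M by (intro bracket_left) auto
    show "\<phi> (br x y) = br (\<phi> x) (\<phi> y)" if "x \<in> M" "y \<in> M" "itinerary_dist \<mu> x y \<le> e"
      "itinerary_dist \<mu> (\<phi> x) (\<phi> y) \<le> e" for x y
      using that close' phi_in_M by (intro bracket_equivariant) auto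
    show "itinerary_dist \<mu> (\<phi> y) (\<phi> z) \<le> inverse (inverse \<mu>) * itinerary_dist \<mu> y z"
      if x: "x \<in> M" "0 < e'" "e' \<le> e" and y: "y \<in> local_stable M (itinerary_dist \<mu>) br x e'"
        and z: "z \<in> local_stable M (itinerary_dist \<mu>) br x e'" for x y z e'
    proof -
      have "same_cell ((\<phi> ^^ i) y) ((\<phi> ^^ i) z)" for i
        using stable_same[OF x(1) stable[OF x(1,3) y], of i] stable_same[OF x(1) stable[OF x(1,3) z], of i]
          same_cell_sym same_cell_trans by blast
      then show ?thesis using itinerary_dist_phi_contract[of y z] y z by (simp add: local_stable_def)
    qed
    show "itinerary_dist \<mu> (\<psi> y) (\<psi> z) \<le> inverse (inverse \<mu>) * itinerary_dist \<mu> y z"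
      if x: "x \<in> M" "0 < e'" "e' \<le> e" and y: "y \<in> local_unstable M (itinerary_dist \<mu>) br x e'"
        and z: "z \<in> local_unstable M (itinerary_dist \<mu>) br x e'" for x y z e'
    proof -
      have "same_cell ((\<psi> ^^ i) y) ((\<psi> ^^ i) z)" for i
        using unstable_same[OF x(1) unstable[OF x(1,3) y], of i] unstable_same[OF x(1) unstable[OF x(1,3) z], of i]
          same_cell_sym same_cell_trans by blast
      then show ?thesis using itinerary_dist_psi_contract[of y z] y z by (simp add: local_unstable_def)
    qed
    show "itinerary_dist \<mu> (\<phi> x) (\<phi> y) \<le> inverse \<mu> * itinerary_dist \<mu> x y" if "x \<in> M" "y \<in> M" for x y
      using that by (rule itinerary_dist_phi)
    show "itinerary_dist \<mu> (\<psi> x) (\<psi> y) \<le> inverse \<mu> * itinerary_dist \<mu> x y" if "x \<in> M" "y \<in> M" for x y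
      using that by (rule itinerary_dist_psi)
  qed
  then show ?thesis by blast
qed

end
end

text \<open>
  In dimension \<open>0\<close> a fine cover has an open refinement in which every point has at most one member around it,
  that is, a clopen partition below the tracking scale.  The choice of \<open>\<mu> = inverse L\<close> is free.
\<close>

lemma (in smale_space) zero_dim_self_similar_constant:
  assumes dim: "covering_dim_le mtopology 0" and L: "1 < L"
  obtains d' where "d' \<in> self_similar_metrics M d \<phi>" "self_similar_constant M d' \<phi> L"
proof -
  obtain \<delta> where \<delta>0: "0 < \<delta>" and \<delta>: "tracking_scale \<delta>"
    using exponential_tracking .
  obtain \<A> where \<A>: "open_cover mtopology \<A>" "finite \<A>"
    "mesh_le \<A> \<delta>"
    using finite_small_cover[OF compact \<delta>0] .
  obtain \<V> where \<V>: "open_cover mtopology \<V>" "refines \<V> \<A>"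
    "\<forall>x\<in>M. finite {V\<in>\<V>. x \<in> V} \<and> card {V\<in>\<V>. x \<in> V} \<le> 1"
    using dim[unfolded covering_dim_le_def, rule_format, OF \<A>(1)] by auto
  interpret partitioned_smale_space M d \<phi> eps lam br \<V> \<delta>
  proof
    show "open_cover mtopology \<V>" by (rule \<V>(1))
    show "U = V" if "U \<in> \<V>" "V \<in> \<V>" "x \<in> U" "x \<in> V" for U V x
    proof -
      have "x \<in> M" using that \<V>(1) unfolding open_cover_def by auto
      then have "finite {V\<in>\<V>. x \<in> V}" "card {V\<in>\<V>. x \<in> V} \<le> Suc 0" using \<V>(3) by auto
      then show ?thesis using that card_le_Suc0_iff_eq by blast
    qed
    show "mesh_le \<V> \<delta>"
      using \<V>(2) \<A>(3) unfolding refines_def mesh_le_def by (meson subsetD)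
  qed (rule \<delta>)
  have \<mu>: "0 < inverse L" "inverse L < 1" using L by (auto simp: inverse_less_1_iff)
  have const: "self_similar_constant M (itinerary_dist (inverse L)) \<phi> L"
    using itinerary_smale_space[OF \<mu>] unfolding self_similar_constant_def by auto
  show thesis
  proof (rule that[OF _ const])
    show "itinerary_dist (inverse L) \<in> self_similar_metrics M d \<phi>"
      unfolding self_similar_metrics_def
      using itinerary_metric[OF \<mu>] itinerary_topology[OF \<mu>] const by blast
  qed
qed

section \<open>The bound on the lambda number\<close>

theorem proposition6p16:
  fixes M :: "'a set" and d :: "'a \<Rightarrow> 'a \<Rightarrow> real" and \<phi> :: "'a \<Rightarrow> 'a"
    and eps lam :: real and br :: "'a \<Rightarrow> 'a \<Rightarrow> 'a"
  assumes "smale_space M d \<phi> eps lam br"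
    and "irreducible_system (Metric_space.mtopology M d) \<phi>"
  shows "(lambda_number M d \<phi> < \<infinity> \<longleftrightarrow> covering_dim (Metric_space.mtopology M d) > 0) \<and>
         (covering_dim (Metric_space.mtopology M d) > 0 \<longrightarrow>
            lambda_number M d \<phi> \<le>
              exp_ereal (2 * topological_entropy (Metric_space.mtopology M d) \<phi> /
                         ereal_of_enat (covering_dim (Metric_space.mtopology M d))))"
proof -
  interpret smale_space M d \<phi> eps lam br by (rule assms(1))
  obtain h where h: "topological_entropy mtopology \<phi> = ereal h" by (rule topological_entropy_real)
  let ?D = "covering_dim mtopology"
  let ?S = "{ereal lam | d' lam. d' \<in> self_similar_metrics M d \<phi> \<and> self_similar_constant M d' \<phi> lam}"
  have bound: "\<exists>n. ?D = enat n \<and> 0 < n \<and> l \<le> exp (2 * h / real n)"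
    if pos: "?D > 0" and d': "d' \<in> self_similar_metrics M d \<phi>" "self_similar_constant M d' \<phi> l" for d' l
  proof -
    obtain e b where "self_similar_smale_space M d' \<phi> e l b"
      using d'(2) unfolding self_similar_constant_def by blast
    then interpret S: self_similar_smale_space M d' \<phi> e l b .
    have top: "S.mtopology = mtopology" using d'(1) by (simp add: self_similar_metrics_def)
    obtain n where n: "?D = enat n" "0 < n" "real n * ln l \<le> 2 * h"
      using S.covering_dim_lam_le_entropy[of h] h pos unfolding top by blast
    have "ln l \<le> 2 * h / real n" using n(2,3) by (simp add: field_simps)
    then have "exp (ln l) \<le> exp (2 * h / real n)" by simp
    then show ?thesis using n S.lam_gt_1 by auto
  qed
  have le: "lambda_number M d \<phi> \<le> exp_ereal (2 * ereal h / ereal_of_enat ?D)" if pos: "?D > 0"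
    unfolding lambda_number_def
  proof (rule Sup_least)
    fix x assume "x \<in> ?S"
    then obtain d' l where l: "x = ereal l" "d' \<in> self_similar_metrics M d \<phi>" "self_similar_constant M d' \<phi> l"
      by blast
    obtain n where n: "?D = enat n" "0 < n" "l \<le> exp (2 * h / real n)" using bound[OF pos l(2,3)] by blast
    have "2 * ereal h / ereal_of_enat ?D = ereal (2 * h / real n)" using n(1,2) by simp
    then show "x \<le> exp_ereal (2 * ereal h / ereal_of_enat ?D)" using n(3) l(1) by simp
  qed
  have fin: "lambda_number M d \<phi> < \<infinity>" if pos: "?D > 0"
  proof -
    have "exp_ereal (2 * ereal h / ereal_of_enat ?D) < \<infinity>"
      using pos by (cases ?D) (auto simp: zero_enat_def zero_ereal_def)
    then show ?thesis using le[OF pos] by (rule le_less_trans[rotated])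
  qed
  have inf: "lambda_number M d \<phi> = \<infinity>" if zero: "\<not> ?D > 0"
  proof -
    have D0: "?D = 0" using zero by simp
    have ne: "{n. covering_dim_le mtopology n} \<noteq> {}"
    proof
      assume "{n. covering_dim_le mtopology n} = {}"
      then have "?D = \<infinity>" unfolding covering_dim_def Inf_enat_def by (simp only: image_empty simp_thms if_True)
      then show False using D0 by simp
    qed
    then obtain m where "enat m \<in> enat ` {n. covering_dim_le mtopology n}" by blast
    then have "?D \<in> enat ` {n. covering_dim_le mtopology n}"
      unfolding covering_dim_def by (rule wellorder_InfI)
    then have dim: "covering_dim_le mtopology 0" using D0 by (auto simp: zero_enat_def)
    have "ereal (real n) \<le> lambda_number M d \<phi>" for n :: nat
    proof -
      obtain d' where "d' \<in> self_similar_metrics M d \<phi>" "self_similar_constant M d' \<phi> (real n + 2)"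
        by (rule zero_dim_self_similar_constant[OF dim, of "real n + 2"]) auto
      then have "ereal (real n + 2) \<le> lambda_number M d \<phi>"
        unfolding lambda_number_def by (intro Sup_upper) blast
      moreover have "ereal (real n) \<le> ereal (real n + 2)" by simp
      ultimately show ?thesis by (rule order_trans[rotated])
    qed
    then show ?thesis by (intro ereal_top) (metis ereal_less_eq(3) order_trans real_arch_simple)
  qed
  show ?thesis using le fin inf unfolding h by fastforce
qed

end
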